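(* Let $X = X(\omega_1)$ be the inverse limit constructed in the context (with connecting arcs at successor stages). Then $X$ is $\aleph_1$-cellular, hence non-separable.
   Context: A continuum is a nondegenerate compact connected Hausdorff space; a subcontinuum is a subspace that is itself a continuum. A continuum is $\aleph_1$-cellular if it admits a family of $\aleph_1$-many pairwise disjoint nonempty open subsets. For points $a,b$ of a continuum, $[a,b]$ denotes the intersection of all subcontinua containing $\{a,b\}$. $\mathbb N = \{1,2,\ldots\}$. Construction of $X$. By transfinite recursion one defines, for each $\alpha \le \omega_1$, a continuum $X(\alpha)$, a point $a_\alpha \in X(\alpha)$, a sequence of points $(q^n_\alpha)_{n \in \mathbb N}$ in $X(\alpha)$, and, for each $\beta \le \alpha$, a continuous map $f^\alpha_\beta : X(\alpha) \to X(\beta)$ (with $f^\alpha_\alpha = \mathrm{id}$) together with an embedding of $X(\beta)$ as a subspace of $X(\alpha)$ for which $f^\alpha_\beta$ is a retraction. Stage $0$: $X(0)$ is the $\sin(1/x)$ continuum $\{(x,\sin(1/x)) : -2/\pi \le x < 0\} \cup (\{0\}\times[-1,1])$, $a_0 = (-2/\pi,-1)$, and $(q^n_0)$ is a chosen sequence of points of the graph $\{(x,\sin(1/x)) : -2/\pi < x < 0\}$ whose $x$-coordinates strictly increase to $0$. Successor stage: $X(\beta+1)$ is the subspace of $X(\beta)\times[0,1]$ that is the union of the three sets $\bigcup_{n\in\mathbb N} \big([a_\beta,q^n_\beta]\times\{1/(2n-1),1/(2n)\}\big) \cup (X(\beta)\times\{0\})$, $\ \bigcup_{n\in\mathbb N}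 \big(\{q^n_\beta\}\times[1/(2n),1/(2n-1)]\big)$, and $\bigcup_{n\in\mathbb N}\big(\{a_\beta\}\times[1/(2n+1),1/(2n)]\big)$. $X(\beta)$ is identified with $X(\beta)\times\{0\}$; $f^{\beta+1}_\beta$ is the restriction of the projection $X(\beta)\times[0,1]\to X(\beta)$; $f^{\beta+1}_\gamma = f^\beta_\gamma\circ f^{\beta+1}_\beta$ for $\gamma\le\beta$; $a_{\beta+1} = (a_\beta,1)$; and $q^n_{\beta+1} = (q^n_\beta,1/(2n-1))$. Limit stage ($\alpha\le\omega_1$ a limit ordinal): $X(\alpha) = \varprojlim\{X(\beta); f^\beta_\gamma : \gamma\le\beta<\alpha\}$, the maps $f^\alpha_\beta$ are the projections, $a_\alpha = (a_\beta)_{\beta<\alpha}$, $q^n_\alpha = (q^n_\beta)_{\beta<\alpha}$, and for $\gamma<\alpha$ the space $X(\gamma)$ is identified with the subspace $\{x\in X(\alpha) : x_\beta = x_\gamma \text{ for all } \gamma\le\beta<\alpha\}$ (using $X(\gamma)\subset X(\beta)$). Finally $X = X(\omega_1)$. *)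

theory Defs
  imports "HOL-Analysis.Analysis"
begin

unbundle cardinal_syntax

section \<open>Ordinals below \<open>\<omega>\<^sub>2\<close>\<close>

text \<open>Working below \<open>\<omega>\<^sub>2\<close> makes \<open>\<omega>\<^sub>1\<close> itself an index and makes every index
  have a successor; only indices \<open>\<alpha> \<le> \<omega>\<^sub>1\<close> matter.\<close>

typedef ordinal = "Field (cardSuc (cardSuc natLeq))"
proof -
  have "Field (cardSuc (cardSuc natLeq)) \<noteq> {}"
    by (metis Field_natLeq cardSuc_Card_order cardSuc_finite finite.emptyI infinite_UNIV_nat natLeq_Card_order)
  then show ?thesis by blast
qed

lemma Card_order_ordinal: "Card_order (cardSuc (cardSuc natLeq))"
  by (simp add: cardSuc_Card_order natLeq_Card_order)

lemma Well_order_ordinal: "Well_order (cardSuc (cardSuc natLeq))"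
  using Card_order_ordinal by (rule Card_order_wo_rel[unfolded wo_rel_def])

instantiation ordinal :: wellorder
begin

definition less_eq_ordinal :: "ordinal \<Rightarrow> ordinal \<Rightarrow> bool" where
  "\<alpha> \<le> \<beta> \<longleftrightarrow> (Rep_ordinal \<alpha>, Rep_ordinal \<beta>) \<in> cardSuc (cardSuc natLeq)"

definition less_ordinal :: "ordinal \<Rightarrow> ordinal \<Rightarrow> bool" where
  "(\<alpha> :: ordinal) < \<beta> \<longleftrightarrow> \<alpha> \<le> \<beta> \<and> \<alpha> \<noteq> \<beta>"

instance
proof -
  let ?r = "cardSuc (cardSuc natLeq)"
  have W: "wo_rel ?r" using Well_order_ordinal by (simp add: wo_rel_def)
  have refl: "x \<le> x" for x :: ordinal
    using wo_rel.REFL[OF W] Rep_ordinal by (auto simp: less_eq_ordinal_def refl_on_def)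
  have trans: "x \<le> z" if "x \<le> y" "y \<le> z" for x y z :: ordinal
    using wo_rel.TRANS[OF W] that unfolding less_eq_ordinal_def by (meson transD)
  have anti: "x = y" if "x \<le> y" "y \<le> x" for x y :: ordinal
    using wo_rel.ANTISYM[OF W] that unfolding less_eq_ordinal_def
    by (metis Rep_ordinal_inject antisymD)
  have tot: "x \<le> y \<or> y \<le> x" for x y :: ordinal
    using wo_rel.TOTALS[OF W] Rep_ordinal unfolding less_eq_ordinal_def by blast
  have wf: "P a" if step: "\<And>x. (\<And>y. y < x \<Longrightarrow> P y) \<Longrightarrow> P x" for P and a :: ordinal
  proof -
    have "wf (?r - Id)" using wo_rel.WF[OF W] .
    then have "wf (inv_image (?r - Id) Rep_ordinal)" by (rule wf_inv_image)
    then show ?thesis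
    proof (induction a rule: wf_induct_rule)
      case (less x)
      show ?case
        by (rule step, rule less)
          (auto simp: less_ordinal_def less_eq_ordinal_def Rep_ordinal_inject)
    qed
  qed
  show "OFCLASS(ordinal, wellorder_class)"
  proof intro_classes
    show "x < y \<longleftrightarrow> x \<le> y \<and> \<not> y \<le> x" for x y :: ordinal
      using anti refl by (auto simp: less_ordinal_def)
  qed (fact refl trans anti tot wf)+
qed

end

instantiation ordinal :: zero
begin

definition zero_ordinal :: ordinal where "0 = (LEAST \<alpha> :: ordinal. True)"

instance ..

end

definition osucc :: "ordinal \<Rightarrow> ordinal" where
  "osucc \<alpha> = (LEAST \<beta>. \<alpha> < \<beta>)"

definition olimit :: "ordinal \<Rightarrow> bool" where
  "olimit \<alpha> \<longleftrightarrow> \<alpha> \<noteq> 0 \<and> (\<forall>\<beta>. \<alpha> \<noteq> osucc \<beta>)"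

definition omega1 :: ordinal where
  "omega1 = (LEAST \<alpha>. uncountable {..<\<alpha>})"

lemma zero_ordinal_le [simp]: "0 \<le> (\<alpha> :: ordinal)"
  unfolding zero_ordinal_def by (rule Least_le) simp

lemma infinite_ordinal: "infinite (Field (cardSuc (cardSuc natLeq)))"
  by (metis Field_natLeq cardSuc_Card_order cardSuc_finite infinite_UNIV_nat natLeq_Card_order)

lemma ordinal_no_max: "\<exists>\<beta>. (\<alpha> :: ordinal) < \<beta>"
proof -
  obtain b where "b \<in> Field (cardSuc (cardSuc natLeq))" "Rep_ordinal \<alpha> \<noteq> b"
      "(Rep_ordinal \<alpha>, b) \<in> cardSuc (cardSuc natLeq)"
    using infinite_Card_order_limit[OF Card_order_ordinal infinite_ordinal Rep_ordinal] by blast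
  then have "\<alpha> < Abs_ordinal b"
    by (auto simp: less_ordinal_def less_eq_ordinal_def Abs_ordinal_inverse)
  then show ?thesis by blast
qed

lemma less_osucc [simp]: "\<alpha> < osucc \<alpha>"
  unfolding osucc_def by (rule LeastI_ex) (rule ordinal_no_max)

lemma less_osucc_iff: "\<gamma> < osucc \<alpha> \<longleftrightarrow> \<gamma> \<le> \<alpha>"
  using less_osucc[of \<alpha>] unfolding osucc_def by (meson not_less_Least le_less_trans not_le)

lemma osucc_inject [simp]: "osucc \<alpha> = osucc \<beta> \<longleftrightarrow> \<alpha> = \<beta>"
  by (metis less_osucc less_osucc_iff order_antisym)

lemma osucc_neq_0 [simp]: "osucc \<alpha> \<noteq> 0"
  by (metis less_osucc not_le zero_ordinal_le)

lemma ordinal_cases: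
  obtains "\<alpha> = 0" | \<beta> where "\<alpha> = osucc \<beta>" | "olimit \<alpha>"
  unfolding olimit_def by blast

lemma uncountable_omega1: "uncountable {..<omega1}"
  and countable_below_omega1: "\<alpha> < omega1 \<Longrightarrow> countable {..<\<alpha>}"
  and card_of_omega1: "|{..<omega1}| =o cardSuc natLeq"
proof -
  let ?r = "cardSuc (cardSuc natLeq)" and ?s = "cardSuc natLeq"
  have s: "Card_order ?s" by (simp add: cardSuc_Card_order natLeq_Card_order)
  then have Ws: "Well_order ?s" by (rule Card_order_wo_rel[unfolded wo_rel_def])
  have "?s <o ?r" using s by (rule cardSuc_greater)
  then obtain a where a: "a \<in> Field ?r" "?s =o Restr ?r (underS ?r a)"
    using ordLess_iff_ordIso_Restr[OF Well_order_ordinal Ws] by blast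
  have F: "Field (Restr ?r (underS ?r a)) = underS ?r a"
    by (rule Refl_Field_Restr2)
      (use Well_order_ordinal in \<open>auto simp: order_on_defs Order_Relation.underS_Field\<close>)
  have "|Field ?s| =o |underS ?r a|"
    using card_of_cong[OF a(2)] F by simp
  then have cu: "|underS ?r a| =o ?s"
    using card_of_Field_ordIso[OF s] ordIso_symmetric ordIso_transitive by blast
  have "underS ?r a = Rep_ordinal ` {..<Abs_ordinal a}"
  proof
    show "underS ?r a \<subseteq> Rep_ordinal ` {..<Abs_ordinal a}"
    proof
      fix b assume "b \<in> underS ?r a"
      then have b: "b \<noteq> a" "(b, a) \<in> ?r" by (auto simp: underS_def)
      then have "b \<in> Field ?r" by (auto simp: Field_def)
      then show "b \<in> Rep_ordinal ` {..<Abs_ordinal a}" using b a(1)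
        by (intro image_eqI[of _ _ "Abs_ordinal b"])
          (auto simp: less_ordinal_def less_eq_ordinal_def Abs_ordinal_inverse Abs_ordinal_inject)
    qed
    show "Rep_ordinal ` {..<Abs_ordinal a} \<subseteq> underS ?r a" using a(1)
      by (auto simp: underS_def less_ordinal_def less_eq_ordinal_def Abs_ordinal_inverse Rep_ordinal_inverse)
  qed
  then have "|underS ?r a| =o |{..<Abs_ordinal a}|"
    by (metis Rep_ordinal_inject card_of_ordIsoI inj_on_imp_bij_betw inj_onI ordIso_symmetric)
  then have ca: "|{..<Abs_ordinal a}| =o ?s"
    using cu ordIso_symmetric ordIso_transitive by blast
  have unc: "uncountable A \<longleftrightarrow> ?s \<le>o |A|" for A :: "ordinal set"
  proof -
    have "countable A \<longleftrightarrow> |A| \<le>o natLeq"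
    proof -
      have "countable A \<longleftrightarrow> |A| \<le>o |UNIV :: nat set|"
        by (simp add: countable_def flip: card_of_ordLeq)
      then show ?thesis
        using card_of_nat ordLeq_ordIso_trans ordIso_symmetric by blast
    qed
    then have "uncountable A \<longleftrightarrow> natLeq <o |A|"
      by (simp add: not_ordLeq_iff_ordLess natLeq_Well_order card_of_Well_order)
    then show ?thesis
      using cardSuc_ordLess_ordLeq[OF natLeq_Card_order card_of_Card_order] by (rule trans)
  qed
  have ua: "uncountable {..<Abs_ordinal a}"
    using unc ca ordIso_iff_ordLeq by blast
  show u: "uncountable {..<omega1}"
    unfolding omega1_def using ua by (rule LeastI)
  show "\<alpha> < omega1 \<Longrightarrow> countable {..<\<alpha>}"
    unfolding omega1_def using not_less_Least by blast
  have "omega1 \<le> Abs_ordinal a"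
    unfolding omega1_def using ua by (rule Least_le)
  then have "|{..<omega1}| \<le>o |{..<Abs_ordinal a}|"
    by (intro card_of_mono1) auto
  then show "|{..<omega1}| =o ?s"
    using ca u unc ordIso_iff_ordLeq ordLeq_ordIso_trans by blast
qed


lemma olimit_omega1: "olimit omega1"
proof -
  have "omega1 \<noteq> 0"
  proof
    assume "omega1 = 0"
    then have "{..<omega1} = {}" using leD[OF zero_ordinal_le] by auto
    then show False using uncountable_omega1 by simp
  qed
  moreover have "omega1 \<noteq> osucc \<beta>" for \<beta>
  proof
    assume *: "omega1 = osucc \<beta>"
    have "{..<osucc \<beta>} = insert \<beta> {..<\<beta>}" by (auto simp: less_osucc_iff)
    moreover have "countable {..<\<beta>}" by (rule countable_below_omega1) (simp add: *)
    ultimately show False using uncountable_omega1 unfolding * by simp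
  qed
  ultimately show ?thesis by (simp add: olimit_def)
qed


section \<open>Continua\<close>

definition continuum :: "'a topology \<Rightarrow> bool" where
  "continuum T \<longleftrightarrow> compact_space T \<and> connected_space T \<and> Hausdorff_space T \<and>
     (\<exists>x\<in>topspace T. \<exists>y\<in>topspace T. x \<noteq> y)"

definition subcontinuum :: "'a topology \<Rightarrow> 'a set \<Rightarrow> bool" where
  "subcontinuum T K \<longleftrightarrow> K \<subseteq> topspace T \<and> continuum (subtopology T K)"

definition interval :: "'a topology \<Rightarrow> 'a \<Rightarrow> 'a \<Rightarrow> 'a set" where
  "interval T a b = {x \<in> topspace T. \<forall>K. subcontinuum T K \<and> {a, b} \<subseteq> K \<longrightarrow> x \<in> K}"

definition aleph1_cellular :: "'a topology \<Rightarrow> bool" where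
  "aleph1_cellular T \<longleftrightarrow> continuum T \<and>
     (\<exists>\<U>. |\<U>| =o cardSuc natLeq \<and> (\<forall>U\<in>\<U>. openin T U \<and> U \<noteq> {}) \<and> disjoint \<U>)"


section \<open>The construction\<close>

definition sin_curve :: "(real \<times> real) set" where
  "sin_curve = {(x, sin (1 / x)) | x. - 2 / pi \<le> x \<and> x < 0} \<union> {0} \<times> {-1..1}"

definition chosen_sequence :: "(nat \<Rightarrow> real \<times> real) \<Rightarrow> bool" where
  "chosen_sequence p \<longleftrightarrow>
     (\<forall>n\<ge>1. p n \<in> {(x, sin (1 / x)) | x. - 2 / pi < x \<and> x < 0}) \<and>
     strict_mono_on {1..} (\<lambda>n. fst (p n)) \<and>
     (\<lambda>n. fst (p n)) \<longlonglongrightarrow> 0"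

definition succ_space :: "'a topology \<Rightarrow> 'a \<Rightarrow> (nat \<Rightarrow> 'a) \<Rightarrow> ('a \<times> real) set" where
  "succ_space T a q =
     ((\<Union>n\<in>{1..}. interval T a (q n) \<times> {1 / (2 * real n - 1), 1 / (2 * real n)}) \<union> topspace T \<times> {0}) \<union>
     (\<Union>n\<in>{1..}. {q n} \<times> {1 / (2 * real n) .. 1 / (2 * real n - 1)}) \<union>
     (\<Union>n\<in>{1..}. {a} \<times> {1 / (2 * real n + 1) .. 1 / (2 * real n)})"

text \<open>All stages live in one type of points: a point of the initial plane together with one
  real coordinate for each successor step already performed, and coordinate \<open>0\<close> for the steps
  not yet performed.  A point \<open>(x, t)\<close> of \<open>X(\<beta>) \<times> [0, 1]\<close> is coded by \<open>adjoin \<beta> x t\<close> and a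
  thread \<open>(x\<^sub>\<beta>)\<close>, \<open>\<beta> < \<alpha>\<close>, by \<open>glue \<alpha> x\<close>.  With this coding \<open>X(\<beta>) \<times> {0}\<close> is
  \<open>X(\<beta>)\<close>, every embedding is an inclusion, and for each \<open>\<alpha> \<ge> \<beta>\<close> the map
  \<open>f\<^sup>\<alpha>\<^sub>\<beta>\<close> is the restriction of \<open>bond \<beta>\<close>.  The type carries the product topology and
  stages carry the subspace topology; that the coding is a homeomorphism is proved below
  (\<open>homeomorphic_X_zero\<close>, \<open>homeomorphic_X_succ\<close>, \<open>homeomorphic_X_limit\<close>).\<close>

type_synonym point = "(real \<times> real) \<times> (ordinal \<Rightarrow> real)"

definition adjoin :: "ordinal \<Rightarrow> point \<Rightarrow> real \<Rightarrow> point" where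
  "adjoin \<beta> x t = (fst x, (snd x)(\<beta> := t))"

definition bond :: "ordinal \<Rightarrow> point \<Rightarrow> point" where
  "bond \<beta> x = (fst x, \<lambda>\<gamma>. if \<gamma> < \<beta> then snd x \<gamma> else 0)"

definition glue :: "ordinal \<Rightarrow> (ordinal \<Rightarrow> point) \<Rightarrow> point" where
  "glue \<alpha> x = (fst (x 0), \<lambda>\<gamma>. if \<gamma> < \<alpha> then snd (x (osucc \<gamma>)) \<gamma> else 0)"

record stage_data =
  stX :: "point set"
  sta :: point
  stq :: "nat \<Rightarrow> point"

definition zero_stage :: "(nat \<Rightarrow> real \<times> real) \<Rightarrow> stage_data" where
  "zero_stage p =
     \<lparr>stX = (\<lambda>z. (z, \<lambda>_. 0)) ` sin_curve,
      sta = ((- 2 / pi, -1), \<lambda>_. 0),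
      stq = (\<lambda>n. (p n, \<lambda>_. 0))\<rparr>"

definition succ_stage :: "ordinal \<Rightarrow> stage_data \<Rightarrow> stage_data" where
  "succ_stage \<beta> S =
     \<lparr>stX = (\<lambda>(x, t). adjoin \<beta> x t) ` succ_space (top_of_set (stX S)) (sta S) (stq S),
      sta = adjoin \<beta> (sta S) 1,
      stq = (\<lambda>n. adjoin \<beta> (stq S n) (1 / (2 * real n - 1)))\<rparr>"

definition threads :: "ordinal \<Rightarrow> (ordinal \<Rightarrow> point set) \<Rightarrow> (ordinal \<Rightarrow> point) set" where
  "threads \<alpha> Y = {x \<in> (\<Pi>\<^sub>E \<beta>\<in>{..<\<alpha>}. Y \<beta>). \<forall>\<beta><\<alpha>. \<forall>\<gamma>\<le>\<beta>. bond \<gamma> (x \<beta>) = x \<gamma>}"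

definition limit_stage :: "ordinal \<Rightarrow> (ordinal \<Rightarrow> stage_data) \<Rightarrow> stage_data" where
  "limit_stage \<alpha> S =
     \<lparr>stX = glue \<alpha> ` threads \<alpha> (\<lambda>\<beta>. stX (S \<beta>)),
      sta = glue \<alpha> (\<lambda>\<beta>\<in>{..<\<alpha>}. sta (S \<beta>)),
      stq = (\<lambda>n. glue \<alpha> (\<lambda>\<beta>\<in>{..<\<alpha>}. stq (S \<beta>) n))\<rparr>"

definition next_stage ::
    "(nat \<Rightarrow> real \<times> real) \<Rightarrow> ordinal \<Rightarrow> (ordinal \<Rightarrow> stage_data) \<Rightarrow> stage_data" where
  "next_stage p \<alpha> S =
     (if \<alpha> = 0 then zero_stage p
      else if \<exists>\<beta>. \<alpha> = osucc \<beta> then (let \<beta> = (THE \<beta>. \<alpha> = osucc \<beta>) in succ_stage \<beta> (S \<beta>))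
      else limit_stage \<alpha> S)"

function stage :: "(nat \<Rightarrow> real \<times> real) \<Rightarrow> ordinal \<Rightarrow> stage_data" where
  "stage p \<alpha> = next_stage p \<alpha> (\<lambda>\<beta>. if \<beta> < \<alpha> then stage p \<beta> else undefined)"
  by auto
termination
  by (relation "inv_image {(\<beta>, \<alpha>). \<beta> < \<alpha>} snd") (auto simp: wf)

declare stage.simps [simp del]

definition Xs :: "(nat \<Rightarrow> real \<times> real) \<Rightarrow> ordinal \<Rightarrow> point set" where
  "Xs p \<alpha> = stX (stage p \<alpha>)"

definition pt_a :: "(nat \<Rightarrow> real \<times> real) \<Rightarrow> ordinal \<Rightarrow> point" where
  "pt_a p \<alpha> = sta (stage p \<alpha>)"

definition pt_q :: "(nat \<Rightarrow> real \<times> real) \<Rightarrow> nat \<Rightarrow> ordinal \<Rightarrow> point" where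
  "pt_q p n \<alpha> = stq (stage p \<alpha>) n"

abbreviation X_space :: "(nat \<Rightarrow> real \<times> real) \<Rightarrow> ordinal \<Rightarrow> point topology" where
  "X_space p \<alpha> \<equiv> top_of_set (Xs p \<alpha>)"


subsection \<open>The recursion clauses\<close>

lemma stage_zero: "stage p 0 = zero_stage p"
  by (subst stage.simps) (simp add: next_stage_def)

lemma stage_succ: "stage p (osucc \<beta>) = succ_stage \<beta> (stage p \<beta>)"
  by (subst stage.simps) (simp add: next_stage_def Let_def)

lemma stage_limit:
  assumes "olimit \<alpha>"
  shows "stage p \<alpha> = limit_stage \<alpha> (stage p)"
proof -
  have "threads \<alpha> (\<lambda>\<beta>. stX (if \<beta> < \<alpha> then stage p \<beta> else undefined)) = threads \<alpha> (\<lambda>\<beta>. stX (stage p \<beta>))"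
    unfolding threads_def by (intro Collect_cong conj_cong arg_cong2[of _ _ _ _ "(\<in>)"] PiE_cong) auto
  moreover have "(\<lambda>\<beta>\<in>{..<\<alpha>}. g (if \<beta> < \<alpha> then stage p \<beta> else undefined)) = (\<lambda>\<beta>\<in>{..<\<alpha>}. g (stage p \<beta>))"
    for g :: "stage_data \<Rightarrow> point"
    by (rule restrict_ext) simp
  ultimately show ?thesis
    using assms unfolding stage.simps[of p \<alpha>]
    by (auto simp: next_stage_def olimit_def limit_stage_def cong: restrict_cong)
qed

lemma
  shows X_zero: "Xs p 0 = (\<lambda>z. (z, \<lambda>_. 0)) ` sin_curve"
    and a_zero: "pt_a p 0 = ((- 2 / pi, -1), \<lambda>_. 0)"
    and q_zero: "pt_q p n 0 = (p n, \<lambda>_. 0)"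
  by (simp_all add: Xs_def pt_a_def pt_q_def stage_zero zero_stage_def)

lemma
  shows X_succ: "Xs p (osucc \<beta>) =
      (\<lambda>(x, t). adjoin \<beta> x t) ` succ_space (X_space p \<beta>) (pt_a p \<beta>) (\<lambda>n. pt_q p n \<beta>)"
    and a_succ: "pt_a p (osucc \<beta>) = adjoin \<beta> (pt_a p \<beta>) 1"
    and q_succ: "pt_q p n (osucc \<beta>) = adjoin \<beta> (pt_q p n \<beta>) (1 / (2 * real n - 1))"
  by (simp_all add: Xs_def pt_a_def pt_q_def stage_succ succ_stage_def)

lemma
  assumes "olimit \<alpha>"
  shows X_limit: "Xs p \<alpha> = glue \<alpha> ` threads \<alpha> (Xs p)"
    and a_limit: "pt_a p \<alpha> = glue \<alpha> (\<lambda>\<beta>\<in>{..<\<alpha>}. pt_a p \<beta>)"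
    and q_limit: "pt_q p n \<alpha> = glue \<alpha> (\<lambda>\<beta>\<in>{..<\<alpha>}. pt_q p n \<beta>)"
  using assms by (simp_all add: Xs_def pt_a_def pt_q_def stage_limit limit_stage_def Xs_def[abs_def])


subsection \<open>The coding\<close>

lemma olimit_osucc: "olimit \<alpha> \<Longrightarrow> \<gamma> < \<alpha> \<Longrightarrow> osucc \<gamma> < \<alpha>"
  using less_osucc_iff[of \<alpha> \<gamma>] unfolding olimit_def by (metis linorder_neqE not_le)

lemma olimit_pos: "olimit \<alpha> \<Longrightarrow> 0 < \<alpha>"
  using zero_ordinal_le[of \<alpha>] by (auto simp: olimit_def order_le_less)

lemma bond_bond [simp]: "bond \<gamma> (bond \<beta> x) = bond (min \<gamma> \<beta>) x"
  by (auto simp: bond_def)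

lemma bond_adjoin: "\<gamma> \<le> \<beta> \<Longrightarrow> bond \<gamma> (adjoin \<beta> x t) = bond \<gamma> x"
  by (auto simp: bond_def adjoin_def fun_eq_iff)

lemma bond_glue:
  assumes "olimit \<alpha>" "x \<in> threads \<alpha> Y" "\<beta> < \<alpha>" "bond \<beta> (x \<beta>) = x \<beta>"
  shows "bond \<beta> (glue \<alpha> x) = x \<beta>"
proof -
  have th: "\<And>\<gamma> \<delta>. \<gamma> \<le> \<delta> \<Longrightarrow> \<delta> < \<alpha> \<Longrightarrow> bond \<gamma> (x \<delta>) = x \<gamma>"
    using assms(2) by (auto simp: threads_def)
  have 1: "fst (x 0) = fst (x \<beta>)"
    using arg_cong[OF th[of 0 \<beta>], of fst] assms(3) by (simp add: bond_def)
  have 2: "snd (x (osucc \<gamma>)) \<gamma> = snd (x \<beta>) \<gamma>" if "\<gamma> < \<beta>" for \<gamma>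
  proof -
    have "osucc \<gamma> \<le> \<beta>" using that less_osucc_iff not_le by blast
    then have "bond (osucc \<gamma>) (x \<beta>) = x (osucc \<gamma>)" using th assms(3) by blast
    then have "snd (x (osucc \<gamma>)) \<gamma> = snd (bond (osucc \<gamma>) (x \<beta>)) \<gamma>" by simp
    then show ?thesis by (simp add: bond_def)
  qed
  have "bond \<beta> (glue \<alpha> x) = bond \<beta> (x \<beta>)"
    using 1 2 assms(3) by (auto simp: bond_def glue_def fun_eq_iff)
  then show ?thesis using assms(4) by simp
qed

lemma glue_bond:
  assumes "olimit \<alpha>"
  shows "glue \<alpha> (\<lambda>\<beta>\<in>{..<\<alpha>}. bond \<beta> x) = bond \<alpha> x"
  using olimit_osucc[OF assms] olimit_pos[OF assms] by (simp add: glue_def bond_def fun_eq_iff)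

lemma a_zero_in: "((- 2 / pi, -1) :: real \<times> real) \<in> sin_curve"
proof -
  have "sin (1 / (- 2 / pi)) = (-1 :: real)" by (simp add: divide_simps)
  then have "((- 2 / pi, -1) :: real \<times> real) = (- 2 / pi, sin (1 / (- 2 / pi))) \<and>
      - 2 / pi \<le> (- 2 / pi :: real) \<and> - 2 / pi < (0 :: real)"
    by simp
  then show ?thesis unfolding sin_curve_def by blast
qed

lemma q_zero_in: "chosen_sequence p \<Longrightarrow> 1 \<le> n \<Longrightarrow> p n \<in> sin_curve"
  unfolding chosen_sequence_def sin_curve_def using less_imp_le by blast

definition well_coded :: "(nat \<Rightarrow> real \<times> real) \<Rightarrow> ordinal \<Rightarrow> bool" where
  "well_coded p \<alpha> \<longleftrightarrow>
     (\<forall>x\<in>Xs p \<alpha>. bond \<alpha> x = x) \<and> pt_a p \<alpha> \<in> Xs p \<alpha> \<and> (\<forall>n\<ge>1. pt_q p n \<alpha> \<in> Xs p \<alpha>) \<and>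
     (\<forall>\<beta>\<le>\<alpha>. (\<forall>x\<in>Xs p \<alpha>. bond \<beta> x \<in> Xs p \<beta>) \<and> bond \<beta> (pt_a p \<alpha>) = pt_a p \<beta> \<and>
       (\<forall>n\<ge>1. bond \<beta> (pt_q p n \<alpha>) = pt_q p n \<beta>))"

lemma bond_osucc_adjoin:
  assumes "bond \<beta> y = y"
  shows "bond (osucc \<beta>) (adjoin \<beta> y t) = adjoin \<beta> y t"
proof -
  have "snd y \<gamma> = 0" if "\<not> \<gamma> < \<beta>" for \<gamma>
    using arg_cong[OF assms, of "\<lambda>z. snd z \<gamma>"] that by (simp add: bond_def)
  then show ?thesis by (auto simp: bond_def adjoin_def fun_eq_iff less_osucc_iff)
qed

lemma adjoin_0:
  assumes "bond \<beta> y = y"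
  shows "adjoin \<beta> y 0 = y"
proof -
  have "snd y \<beta> = 0" 
    using arg_cong[OF assms, of "\<lambda>z. snd z \<beta>"] by (simp add: bond_def)
  then show ?thesis by (auto simp: adjoin_def prod_eq_iff)
qed

lemma succ_space_subset:
  assumes "c \<in> topspace T" "\<And>n. n \<ge> 1 \<Longrightarrow> d n \<in> topspace T"
  shows "succ_space T c d \<subseteq> topspace T \<times> {0..1}"
proof -
  have b: "1 / (2 * real n - 1) \<le> 1" "1 / (2 * real n) \<le> 1" "0 \<le> 1 / (2 * real n - 1)"
    "0 \<le> 1 / (2 * real n + 1)" "0 \<le> 1 / (2 * real n)" if "n \<ge> 1" for n
    using that by (auto simp: divide_simps)
  have "interval T c (d n) \<times> {1 / (2 * real n - 1), 1 / (2 * real n)} \<subseteq> topspace T \<times> {0..1}"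
    "{d n} \<times> {1 / (2 * real n) .. 1 / (2 * real n - 1)} \<subseteq> topspace T \<times> {0..1}"
    "{c} \<times> {1 / (2 * real n + 1) .. 1 / (2 * real n)} \<subseteq> topspace T \<times> {0..1}"
    if n: "n \<ge> 1" for n
  proof -
    have d: "{d n} \<subseteq> topspace T" and c: "{c} \<subseteq> topspace T" and "interval T c (d n) \<subseteq> topspace T"
      using assms n by (auto simp: interval_def)
    moreover have "{1 / (2 * real n - 1), 1 / (2 * real n)} \<subseteq> {0..1}" using b[OF n] by auto
    moreover have "{1 / (2 * real n) .. 1 / (2 * real n - 1)} \<subseteq> {0..1}"
      using b[OF n] by (metis atLeastatMost_subset_iff)
    moreover have "{1 / (2 * real n + 1) .. 1 / (2 * real n)} \<subseteq> {0..1}"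
      using b[OF n] by (metis atLeastatMost_subset_iff)
    ultimately show
      "interval T c (d n) \<times> {1 / (2 * real n - 1), 1 / (2 * real n)} \<subseteq> topspace T \<times> {0..1}"
      "{d n} \<times> {1 / (2 * real n) .. 1 / (2 * real n - 1)} \<subseteq> topspace T \<times> {0..1}"
      "{c} \<times> {1 / (2 * real n + 1) .. 1 / (2 * real n)} \<subseteq> topspace T \<times> {0..1}"
      by (meson Sigma_mono)+
  qed
  moreover have "topspace T \<times> {0} \<subseteq> topspace T \<times> {0..1::real}" by auto
  ultimately show ?thesis
    unfolding succ_space_def by (intro Un_least UN_least) (simp_all only: atLeast_iff)
qed

lemma well_coded_succ_space:
  "well_coded p \<beta> \<Longrightarrow>
    succ_space (X_space p \<beta>) (pt_a p \<beta>) (\<lambda>n. pt_q p n \<beta>) \<subseteq> Xs p \<beta> \<times> {0..1}"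
  using succ_space_subset[of "pt_a p \<beta>" "X_space p \<beta>" "\<lambda>n. pt_q p n \<beta>"]
  by (simp add: well_coded_def)

lemma well_coded:
  assumes p: "chosen_sequence p"
  shows "well_coded p \<alpha>"
proof (induction \<alpha> rule: less_induct)
  case (less \<alpha>)
  show ?case
  proof (cases \<alpha> rule: ordinal_cases)
    case 1
    then show ?thesis using a_zero_in q_zero_in[OF p]
      by (auto simp: well_coded_def X_zero a_zero q_zero bond_def order_antisym_conv[OF zero_ordinal_le]
          cong: if_cong)
  next
    case (2 \<beta>)
    let ?S = "succ_space (X_space p \<beta>) (pt_a p \<beta>) (\<lambda>n. pt_q p n \<beta>)"
    have IH: "well_coded p \<beta>" using less 2 by simp
    have "(pt_a p \<beta>, 1) \<in> interval (X_space p \<beta>) (pt_a p \<beta>) (pt_q p 1 \<beta>) \<times>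
        {1 / (2 * real 1 - 1), 1 / (2 * real 1)}"
      using IH by (simp add: well_coded_def interval_def)
    then have A: "(pt_a p \<beta>, 1) \<in> ?S" unfolding succ_space_def by blast
    have Q: "(pt_q p n \<beta>, 1 / (2 * real n - 1)) \<in> ?S" if n: "n \<ge> 1" for n
    proof -
      have "(pt_q p n \<beta>, 1 / (2 * real n - 1)) \<in>
          interval (X_space p \<beta>) (pt_a p \<beta>) (pt_q p n \<beta>) \<times> {1 / (2 * real n - 1), 1 / (2 * real n)}"
        using IH n by (simp add: well_coded_def interval_def)
      then show ?thesis using n unfolding succ_space_def by blast
    qed
    have down: "bond \<gamma> (adjoin \<beta> y t) = bond \<gamma> y" if "\<gamma> \<le> \<beta>" for \<gamma> y t
      using that by (simp add: bond_adjoin)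
    have le: "\<gamma> \<le> \<alpha> \<longleftrightarrow> \<gamma> = \<alpha> \<or> \<gamma> \<le> \<beta>" for \<gamma>
      using 2 less_osucc_iff by (auto simp: order_le_less)
    have X: "Xs p \<alpha> = (\<lambda>(x, t). adjoin \<beta> x t) ` ?S" using X_succ 2 by simp
    have fix1: "bond \<alpha> x = x" if x: "x \<in> Xs p \<alpha>" for x
    proof -
      obtain y t where y: "x = adjoin \<beta> y t" "(y, t) \<in> ?S" using x X by auto
      then have "y \<in> Xs p \<beta>" using well_coded_succ_space[OF IH] by auto
      then show ?thesis using y 2 IH bond_osucc_adjoin by (simp add: well_coded_def)
    qed
    have low: "bond \<gamma> x \<in> Xs p \<gamma>" if x: "x \<in> Xs p \<alpha>" and g: "\<gamma> \<le> \<beta>" for x \<gamma>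
    proof -
      obtain y t where y: "x = adjoin \<beta> y t" "(y, t) \<in> ?S" using x X by auto
      then have "y \<in> Xs p \<beta>" using well_coded_succ_space[OF IH] by auto
      then show ?thesis using y g down IH by (simp add: well_coded_def)
    qed
    have a: "pt_a p \<alpha> = adjoin \<beta> (pt_a p \<beta>) 1" using 2 a_succ by simp
    have q: "pt_q p n \<alpha> = adjoin \<beta> (pt_q p n \<beta>) (1 / (2 * real n - 1))" for n
      using 2 q_succ by simp
    have aX: "pt_a p \<alpha> \<in> Xs p \<alpha>" unfolding a X using A by force
    have qX: "pt_q p n \<alpha> \<in> Xs p \<alpha>" if "n \<ge> 1" for n unfolding q X using Q[OF that] by force
    show ?thesis
      unfolding well_coded_def
    proof (intro conjI ballI allI impI)
      show "bond \<gamma> x \<in> Xs p \<gamma>" if "\<gamma> \<le> \<alpha>" "x \<in> Xs p \<alpha>" for \<gamma> x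
        using that le fix1 low by metis
      show "bond \<gamma> (pt_a p \<alpha>) = pt_a p \<gamma>" if "\<gamma> \<le> \<alpha>" for \<gamma>
        using that le fix1 aX a down IH by (metis well_coded_def)
      show "bond \<gamma> (pt_q p n \<alpha>) = pt_q p n \<gamma>" if "\<gamma> \<le> \<alpha>" "1 \<le> n" for \<gamma> n
        using that le fix1 qX q down IH by (metis well_coded_def)
    qed (use fix1 aX qX in auto)
  next
    case 3
    have IH: "well_coded p \<beta>" if "\<beta> < \<alpha>" for \<beta> using less that by simp
    have X: "Xs p \<alpha> = glue \<alpha> ` threads \<alpha> (Xs p)" using 3 by (rule X_limit)
    have thr: "bond \<beta> (glue \<alpha> x) = x \<beta>" "x \<beta> \<in> Xs p \<beta>"
      if "x \<in> threads \<alpha> (Xs p)" "\<beta> < \<alpha>" for x \<beta>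
    proof -
      show "x \<beta> \<in> Xs p \<beta>" using that by (auto simp: threads_def)
      then show "bond \<beta> (glue \<alpha> x) = x \<beta>"
        using bond_glue[OF 3 that] IH[OF that(2)] by (simp add: well_coded_def)
    qed
    have glue_fix: "bond \<alpha> (glue \<alpha> x) = glue \<alpha> x" for x
      by (auto simp: bond_def glue_def)
    have aT: "(\<lambda>\<beta>\<in>{..<\<alpha>}. pt_a p \<beta>) \<in> threads \<alpha> (Xs p)"
      using IH by (auto simp: threads_def well_coded_def)
    have qT: "(\<lambda>\<beta>\<in>{..<\<alpha>}. pt_q p n \<beta>) \<in> threads \<alpha> (Xs p)" if "n \<ge> 1" for n
      using IH that by (auto simp: threads_def well_coded_def)
    have fix1: "bond \<alpha> x = x" if "x \<in> Xs p \<alpha>" for x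
      using that X glue_fix by auto
    have aX: "pt_a p \<alpha> \<in> Xs p \<alpha>" unfolding a_limit[OF 3] X using aT by blast
    have qX: "pt_q p n \<alpha> \<in> Xs p \<alpha>" if "n \<ge> 1" for n
      unfolding q_limit[OF 3] X using qT[OF that] by blast
    show ?thesis
      unfolding well_coded_def
    proof (intro conjI ballI allI impI)
      show "bond \<gamma> x \<in> Xs p \<gamma>" if "\<gamma> \<le> \<alpha>" "x \<in> Xs p \<alpha>" for \<gamma> x
        using that fix1 thr X by (cases "\<gamma> = \<alpha>") auto
      show "bond \<gamma> (pt_a p \<alpha>) = pt_a p \<gamma>" if "\<gamma> \<le> \<alpha>" for \<gamma>
        using that fix1[OF aX] thr(1)[OF aT] by (cases "\<gamma> = \<alpha>") (auto simp: a_limit[OF 3])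
      show "bond \<gamma> (pt_q p n \<alpha>) = pt_q p n \<gamma>" if "\<gamma> \<le> \<alpha>" "1 \<le> n" for \<gamma> n
        using that fix1[OF qX] thr(1)[OF qT] by (cases "\<gamma> = \<alpha>") (auto simp: q_limit[OF 3])
    qed (use fix1 aX qX in auto)
  qed
qed

lemma
  assumes "chosen_sequence p"
  shows bond_fixed: "x \<in> Xs p \<alpha> \<Longrightarrow> bond \<alpha> x = x"
    and bond_in: "x \<in> Xs p \<alpha> \<Longrightarrow> \<beta> \<le> \<alpha> \<Longrightarrow> bond \<beta> x \<in> Xs p \<beta>"
    and a_in: "pt_a p \<alpha> \<in> Xs p \<alpha>"
    and q_in: "n \<ge> 1 \<Longrightarrow> pt_q p n \<alpha> \<in> Xs p \<alpha>"
    and bond_a: "\<beta> \<le> \<alpha> \<Longrightarrow> bond \<beta> (pt_a p \<alpha>) = pt_a p \<beta>"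
    and bond_q: "n \<ge> 1 \<Longrightarrow> \<beta> \<le> \<alpha> \<Longrightarrow> bond \<beta> (pt_q p n \<alpha>) = pt_q p n \<beta>"
  using well_coded[OF assms, of \<alpha>] unfolding well_coded_def by blast+

lemma bond_above:
  assumes "chosen_sequence p" "x \<in> Xs p \<beta>" "\<beta> \<le> \<gamma>"
  shows "bond \<gamma> x = x"
proof -
  have "bond \<gamma> (bond \<beta> x) = bond \<beta> x" using assms(3) by (simp add: min_absorb2)
  then show ?thesis using bond_fixed[OF assms(1,2)] by simp
qed

lemma X_mono:
  assumes p: "chosen_sequence p"
  shows "\<beta> \<le> \<alpha> \<Longrightarrow> Xs p \<beta> \<subseteq> Xs p \<alpha>"
proof (induction \<alpha> rule: less_induct)
  case (less \<alpha>)
  show ?case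
  proof (cases "\<beta> = \<alpha>")
    case False
    then have lt: "\<beta> < \<alpha>" using less.prems by simp
    show ?thesis
    proof (cases \<alpha> rule: ordinal_cases)
      case 1
      then show ?thesis using lt leD[OF zero_ordinal_le[of \<beta>]] by simp
    next
      case (2 \<gamma>)
      then have "Xs p \<beta> \<subseteq> Xs p \<gamma>" using less lt by (simp add: less_osucc_iff)
      moreover have "Xs p \<gamma> \<subseteq> Xs p \<alpha>"
      proof
        fix x assume x: "x \<in> Xs p \<gamma>"
        then have "x = adjoin \<gamma> x 0" using adjoin_0[OF bond_fixed[OF p x]] by simp
        moreover have "(x, 0) \<in> succ_space (X_space p \<gamma>) (pt_a p \<gamma>) (\<lambda>n. pt_q p n \<gamma>)"
          using x by (simp add: succ_space_def)
        ultimately have "x \<in> (\<lambda>(x, t). adjoin \<gamma> x t) `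
            succ_space (X_space p \<gamma>) (pt_a p \<gamma>) (\<lambda>n. pt_q p n \<gamma>)"
          by (intro image_eqI[of _ _ "(x, 0)"]) auto
        then show "x \<in> Xs p \<alpha>" unfolding 2 X_succ .
      qed
      ultimately show ?thesis by blast
    next
      case 3
      show ?thesis
      proof
        fix x assume x: "x \<in> Xs p \<beta>"
        have x': "bond \<gamma> x = x" if "\<beta> \<le> \<gamma>" for \<gamma>
          using bond_above[OF p x that] .
        have "bond \<gamma> x \<in> Xs p \<gamma>" if "\<gamma> < \<alpha>" for \<gamma>
        proof (cases "\<gamma> \<le> \<beta>")
          case True
          then show ?thesis using bond_in[OF p x] by blast
        next
          case False
          then have "\<beta> \<le> \<gamma>" by simp
          then show ?thesis using less.IH[OF that] x x'[of \<gamma>] by auto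
        qed
        then have "(\<lambda>\<gamma>\<in>{..<\<alpha>}. bond \<gamma> x) \<in> threads \<alpha> (Xs p)"
          by (auto simp: threads_def min_absorb1)
        moreover have "glue \<alpha> (\<lambda>\<gamma>\<in>{..<\<alpha>}. bond \<gamma> x) = x"
          using glue_bond[OF 3] x' less.prems by simp
        ultimately show "x \<in> Xs p \<alpha>" unfolding X_limit[OF 3] by (metis imageI)
      qed
    qed
  qed simp
qed

text \<open>The identification of \<open>X(\<gamma>)\<close> with a subspace of the inverse limit.\<close>

lemma X_subspace_limit:
  assumes p: "chosen_sequence p" and \<alpha>: "olimit \<alpha>" and \<gamma>: "\<gamma> < \<alpha>"
  shows "Xs p \<gamma> = {x \<in> Xs p \<alpha>. \<forall>\<beta>. \<gamma> \<le> \<beta> \<and> \<beta> < \<alpha> \<longrightarrow> bond \<beta> x = bond \<gamma> x}"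
proof (intro equalityI subsetI CollectI conjI allI impI)
  fix x assume x: "x \<in> Xs p \<gamma>"
  show "x \<in> Xs p \<alpha>" using X_mono[OF p less_imp_le[OF \<gamma>]] x by blast
  show "bond \<beta> x = bond \<gamma> x" if "\<gamma> \<le> \<beta> \<and> \<beta> < \<alpha>" for \<beta>
    using bond_above[OF p x] bond_fixed[OF p x] that by simp
next
  fix x assume x: "x \<in> {x \<in> Xs p \<alpha>. \<forall>\<beta>. \<gamma> \<le> \<beta> \<and> \<beta> < \<alpha> \<longrightarrow> bond \<beta> x = bond \<gamma> x}"
  then have xX: "x \<in> Xs p \<alpha>" and h: "\<And>\<beta>. \<gamma> \<le> \<beta> \<Longrightarrow> \<beta> < \<alpha> \<Longrightarrow> bond \<beta> x = bond \<gamma> x"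
    by blast+
  have "bond \<delta> x = bond \<delta> (bond \<gamma> x)" if "\<delta> < \<alpha>" for \<delta>
    using that h[of \<delta>] by (cases "\<gamma> \<le> \<delta>") (auto simp: min_absorb1 min_absorb2)
  then have "(\<lambda>\<delta>\<in>{..<\<alpha>}. bond \<delta> x) = (\<lambda>\<delta>\<in>{..<\<alpha>}. bond \<delta> (bond \<gamma> x))"
    by (intro restrict_ext) auto
  then have "bond \<alpha> x = bond \<gamma> x"
    using glue_bond[OF \<alpha>, of x] glue_bond[OF \<alpha>, of "bond \<gamma> x"] \<gamma> by (simp add: min_absorb2)
  then have "x = bond \<gamma> x" using bond_fixed[OF p xX] by simp
  moreover have "bond \<gamma> x \<in> Xs p \<gamma>" using bond_in[OF p xX] \<gamma> by simp
  ultimately show "x \<in> Xs p \<gamma>" by simp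
qed

lemma continuous_on_point:
  fixes f :: "'a::topological_space \<Rightarrow> point"
  assumes "continuous_on S (\<lambda>x. fst (f x))" "\<And>\<gamma>. continuous_on S (\<lambda>x. snd (f x) \<gamma>)"
  shows "continuous_on S f"
proof -
  have "continuous_on S (\<lambda>x. (fst (f x), snd (f x)))"
    using assms by (intro continuous_on_Pair continuous_on_coordinatewise_then_product)
  then show ?thesis by simp
qed

lemma continuous_on_coord:
  fixes f :: "'a::topological_space \<Rightarrow> point"
  assumes "continuous_on S f"
  shows "continuous_on S (\<lambda>x. snd (f x) \<gamma>)"
  using continuous_on_product_then_coordinatewise[OF continuous_on_snd[OF assms]] .

lemma continuous_on_bond: "continuous_on S (bond \<beta>)"
proof (rule continuous_on_point)
  show "continuous_on S (\<lambda>x. snd (bond \<beta> x) \<gamma>)" for \<gamma>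
    by (cases "\<gamma> < \<beta>") (auto simp: bond_def intro!: continuous_on_coord continuous_intros)
qed (auto simp: bond_def intro!: continuous_intros)

lemma retraction_bond:
  assumes p: "chosen_sequence p" and "\<beta> \<le> \<alpha>"
  shows "retraction_map (X_space p \<alpha>) (X_space p \<beta>) (bond \<beta>)"
  unfolding retraction_map_def retraction_maps_def
proof (intro exI conjI ballI)
  show "continuous_map (X_space p \<alpha>) (X_space p \<beta>) (bond \<beta>)"
    using bond_in[OF p] assms(2) continuous_on_bond by (auto simp: continuous_map_in_subtopology)
  show "continuous_map (X_space p \<beta>) (X_space p \<alpha>) id"
    using X_mono[OF assms] by (auto simp: continuous_map_in_subtopology)
  show "bond \<beta> (id x) = x" if "x \<in> topspace (X_space p \<beta>)" for x
    using that bond_fixed[OF p] by auto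
qed

lemma homeomorphic_X_zero:
  "homeomorphic_maps (top_of_set sin_curve) (X_space p 0) (\<lambda>z. (z, \<lambda>_. 0)) fst"
  by (auto simp: homeomorphic_maps_def X_zero continuous_map_in_subtopology
      intro!: continuous_on_Pair continuous_on_fst continuous_on_id continuous_on_const)

text \<open>The coding identifies \<open>X(\<beta> + 1)\<close> with the prescribed subspace of
  \<open>X(\<beta>) \<times> [0, 1]\<close>, and \<open>bond \<beta>\<close> with the projection.\<close>

lemma homeomorphic_X_succ:
  assumes p: "chosen_sequence p"
  shows "homeomorphic_maps
    (subtopology (prod_topology (X_space p \<beta>) (top_of_set {0..1}))
      (succ_space (X_space p \<beta>) (pt_a p \<beta>) (\<lambda>n. pt_q p n \<beta>)))
    (X_space p (osucc \<beta>))
    (\<lambda>(x, t). adjoin \<beta> x t) (\<lambda>x. (bond \<beta> x, snd x \<beta>))"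
proof -
  let ?S = "succ_space (X_space p \<beta>) (pt_a p \<beta>) (\<lambda>n. pt_q p n \<beta>)"
  have S: "?S \<subseteq> Xs p \<beta> \<times> {0..1}" by (rule well_coded_succ_space[OF well_coded[OF p]])
  have T: "subtopology (prod_topology (X_space p \<beta>) (top_of_set {0..1})) ?S = top_of_set ?S"
    using S by (simp add: subtopology_subtopology Int_absorb1)
  have inv: "bond \<beta> (adjoin \<beta> y t) = y \<and> snd (adjoin \<beta> y t) \<beta> = t" if "y \<in> Xs p \<beta>" for y t
    using bond_fixed[OF p that] by (simp add: bond_adjoin) (simp add: adjoin_def)
  have c: "continuous_on ?S (\<lambda>(x, t). adjoin \<beta> x t)"
    unfolding case_prod_unfold
  proof (rule continuous_on_point)
    show "continuous_on ?S (\<lambda>z. snd (adjoin \<beta> (fst z) (snd z)) \<gamma>)" for \<gamma>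
      by (cases "\<gamma> = \<beta>") (auto simp: adjoin_def intro!: continuous_on_coord continuous_intros)
  qed (auto simp: adjoin_def intro!: continuous_intros)
  have c': "continuous_on (Xs p (osucc \<beta>)) (\<lambda>x. (bond \<beta> x, snd x \<beta>))"
    by (intro continuous_on_Pair continuous_on_bond continuous_on_coord continuous_on_id)
  have fg: "(bond \<beta> (adjoin \<beta> y t), snd (adjoin \<beta> y t) \<beta>) = (y, t)" if "(y, t) \<in> ?S" for y t
    using inv[of y t] S that by blast
  have X: "Xs p (osucc \<beta>) = (\<lambda>(x, t). adjoin \<beta> x t) ` ?S" by (rule X_succ)
  show ?thesis
    unfolding T homeomorphic_maps_def
  proof (intro conjI ballI)
    show "continuous_map (top_of_set ?S) (X_space p (osucc \<beta>)) (\<lambda>(x, t). adjoin \<beta> x t)"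
      using c by (simp add: continuous_map_in_subtopology X)
    show "continuous_map (X_space p (osucc \<beta>)) (top_of_set ?S) (\<lambda>x. (bond \<beta> x, snd x \<beta>))"
      using c' fg by (auto simp: continuous_map_in_subtopology X)
    show "(\<lambda>x. (bond \<beta> x, snd x \<beta>)) ((\<lambda>(x, t). adjoin \<beta> x t) z) = z"
      if "z \<in> topspace (top_of_set ?S)" for z
      using that fg by (cases z) simp
    show "(\<lambda>(x, t). adjoin \<beta> x t) (bond \<beta> x, snd x \<beta>) = x"
      if "x \<in> topspace (X_space p (osucc \<beta>))" for x
      using that fg by (auto simp: X)
  qed
qed

text \<open>The coding identifies \<open>X(\<alpha>)\<close>, \<open>\<alpha>\<close> a limit, with the inverse limit of the earlier
  stages, and \<open>bond \<beta>\<close> with the projections.\<close>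

lemma homeomorphic_X_limit:
  assumes p: "chosen_sequence p" and \<alpha>: "olimit \<alpha>"
  shows "homeomorphic_maps
    (subtopology (product_topology (X_space p) {..<\<alpha>}) (threads \<alpha> (Xs p)))
    (X_space p \<alpha>) (glue \<alpha>) (\<lambda>x. \<lambda>\<beta>\<in>{..<\<alpha>}. bond \<beta> x)"
proof -
  let ?P = "subtopology (product_topology (X_space p) {..<\<alpha>}) (threads \<alpha> (Xs p))"
  have top: "topspace ?P = threads \<alpha> (Xs p)" by (auto simp: threads_def)
  have proj: "continuous_map ?P euclidean (\<lambda>x. x \<beta>)" if "\<beta> < \<alpha>" for \<beta>
    using continuous_map_product_projection[of \<beta> "{..<\<alpha>}" "X_space p"] that
    by (intro continuous_map_from_subtopology) (auto simp: continuous_map_in_subtopology)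
  have inv: "(\<lambda>\<beta>\<in>{..<\<alpha>}. bond \<beta> (glue \<alpha> x)) = x" if x: "x \<in> threads \<alpha> (Xs p)" for x
  proof
    fix \<beta>
    show "(\<lambda>\<beta>\<in>{..<\<alpha>}. bond \<beta> (glue \<alpha> x)) \<beta> = x \<beta>"
    proof (cases "\<beta> < \<alpha>")
      case True
      moreover have "x \<beta> \<in> Xs p \<beta>" using x True by (auto simp: threads_def)
      ultimately show ?thesis using bond_glue[OF \<alpha> x] bond_fixed[OF p] by simp
    qed (use x in \<open>auto simp: threads_def PiE_def extensional_def\<close>)
  qed
  have thr: "(\<lambda>\<beta>\<in>{..<\<alpha>}. bond \<beta> x) \<in> threads \<alpha> (Xs p)" if "x \<in> Xs p \<alpha>" for x
    using bond_in[OF p that] by (auto simp: threads_def min_absorb1)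
  show ?thesis
    unfolding homeomorphic_maps_def
  proof (intro conjI ballI)
    show "continuous_map ?P (X_space p \<alpha>) (glue \<alpha>)"
    proof -
      have "continuous_map ?P (prod_topology euclidean euclidean) (glue \<alpha>)"
        unfolding continuous_map_pairwise
      proof (intro conjI)
        have "continuous_map ?P euclidean (fst \<circ> (\<lambda>x. x 0))"
          by (rule continuous_map_compose[OF proj[OF olimit_pos[OF \<alpha>]]])
            (simp add: continuous_on_fst continuous_on_id)
        then show "continuous_map ?P euclidean (fst \<circ> glue \<alpha>)"
          by (simp add: glue_def o_def)
        have "continuous_map ?P euclideanreal (\<lambda>x. snd (glue \<alpha> x) \<gamma>)" for \<gamma>
        proof (cases "\<gamma> < \<alpha>")
          case True
          have "continuous_map ?P euclidean ((\<lambda>z. snd z \<gamma>) \<circ> (\<lambda>x. x (osucc \<gamma>)))"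
            by (rule continuous_map_compose[OF proj[OF olimit_osucc[OF \<alpha> True]]])
              (simp add: continuous_on_coord continuous_on_id)
          then show ?thesis using True by (simp add: glue_def o_def)
        qed (simp add: glue_def)
        then show "continuous_map ?P euclidean (snd \<circ> glue \<alpha>)"
          by (simp add: continuous_map_componentwise_UNIV flip: euclidean_product_topology)
      qed
      then show ?thesis
        using \<alpha> by (auto simp: continuous_map_in_subtopology X_limit)
    qed
    show "continuous_map (X_space p \<alpha>) ?P (\<lambda>x. \<lambda>\<beta>\<in>{..<\<alpha>}. bond \<beta> x)"
      using thr retraction_bond[OF p]
      by (auto simp: continuous_map_in_subtopology continuous_map_componentwise
          retraction_map_def retraction_maps_def)
    show "(\<lambda>\<beta>\<in>{..<\<alpha>}. bond \<beta> (glue \<alpha> x)) = x" if "x \<in> topspace ?P" for x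
      using that unfolding top by (rule inv)
    show "glue \<alpha> (\<lambda>\<beta>\<in>{..<\<alpha>}. bond \<beta> x) = x" if "x \<in> topspace (X_space p \<alpha>)" for x
      using that glue_bond[OF \<alpha>] bond_fixed[OF p] by simp
  qed
qed

end

theory Submission
  imports Defs
begin

text \<open>The uncountable family of disjoint open sets comes from the connecting arcs.  At step
  \<open>\<beta>\<close> the open arc \<open>{q\<^sup>1} \<times> (1/2, 1)\<close> is an open subset of \<open>X(\<beta> + 1)\<close>, because no other point
  of \<open>X(\<beta> + 1)\<close> has a height in that range; let \<open>cell p \<beta>\<close> be its preimage in \<open>X\<close>.  If
  \<open>\<beta> < \<gamma>\<close>, a point of the cell of \<open>\<gamma>\<close> projects to \<open>q\<^sup>1\<close> in \<open>X(\<gamma>)\<close> and hence to \<open>q\<^sup>1\<close> in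
  \<open>X(\<beta> + 1)\<close>, which is an end point of the earlier arc; so the cells are pairwise disjoint
  (\<open>bond_cell\<close>, \<open>cells_disjoint\<close>).  There are as many of them as there are countable ordinals,
  and a dense set meets each of them, so it is uncountable.

  Most of the work is to see that \<open>X\<close> is a continuum.  Compactness is routine; the difficulty is
  connectedness, because a successor stage is connected only if the intervals \<open>[a, q\<^sup>n]\<close> of the
  previous stage are, and an intersection of subcontinua need not be connected.  The intervals
  are therefore computed along the recursion (\<open>tame\<close>).  In the initial stage they are arcs of the
  sine graph (\<open>interval_sin_curve\<close>).  In a successor stage, \<open>[a, q\<^sup>n]\<close> is the upper part of the
  staircase that winds down towards \<open>X(\<beta>) \<times> {0}\<close>, cut off at the level of \<open>q\<^sup>n\<close>
  (\<open>interval_total\<close>): a subcontinuum containing both ends cannot avoid the vertical arcs, and its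
  slice at each level passed is again a subcontinuum of \<open>X(\<beta>)\<close>, being the image of the
  subcontinuum under a map that collapses what lies above and below the level to the two ends of
  that level (\<open>slice_of_connected\<close>).  In a limit stage, \<open>[a, q\<^sup>n]\<close> is the inverse limit of the
  earlier intervals (\<open>reach_limit\<close>), and inverse limits of continua are compact and connected
  (\<open>compact_connected_inverse_limit\<close>).\<close>

section \<open>Compact connected sets in Hausdorff spaces\<close>

text \<open>Stages consist of functions on an uncountable index set, so their Hausdorff property cannot come
  from a metric.  The weaker separation classes are declared first because the condition for
  membership in a class must entail the one for each of its superclasses.\<close>

lemma open_eval: "open W \<Longrightarrow> open {f :: 'a \<Rightarrow> 'b :: topological_space. f i \<in> W}"
  using product_topology_basis'[of "{i}" "\<lambda>_. W" "\<lambda>i. i"] by simp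

instance "fun" :: (type, t0_space) t0_space
proof
  fix f g :: "'a \<Rightarrow> 'b"
  assume "f \<noteq> g"
  then obtain i where "f i \<noteq> g i" by blast
  then obtain U where "open U" "\<not> (f i \<in> U \<longleftrightarrow> g i \<in> U)" by (metis separation_t0)
  then show "\<exists>U. open U \<and> \<not> (f \<in> U \<longleftrightarrow> g \<in> U)"
    using open_eval[of U i] by (intro exI[of _ "{h. h i \<in> U}"]) simp
qed

instance "fun" :: (type, t1_space) t1_space
proof
  fix f g :: "'a \<Rightarrow> 'b"
  assume "f \<noteq> g"
  then obtain i where "f i \<noteq> g i" by blast
  then obtain U where "open U" "f i \<in> U" "g i \<notin> U" by (meson t1_space)
  then show "\<exists>U. open U \<and> f \<in> U \<and> g \<notin> U"
    using open_eval[of U i] by (intro exI[of _ "{h. h i \<in> U}"]) simp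
qed

instance "fun" :: (type, t2_space) t2_space
proof
  fix f g :: "'a \<Rightarrow> 'b"
  assume "f \<noteq> g"
  then obtain i where "f i \<noteq> g i" by blast
  then obtain U V where "open U" "open V" "f i \<in> U" "g i \<in> V" "U \<inter> V = {}"
    by (meson hausdorff)
  then show "\<exists>U V. open U \<and> open V \<and> f \<in> U \<and> g \<in> V \<and> U \<inter> V = {}"
    using open_eval[of U i] open_eval[of V i]
    by (intro exI[of _ "{h. h i \<in> U}"] exI[of _ "{h. h i \<in> V}"]) auto
qed

lemma Hausdorff_space_top_of_set: "Hausdorff_space (top_of_set (S :: 'a :: t2_space set))"
proof -
  have "Hausdorff_space (euclidean :: 'a topology)"
    unfolding Hausdorff_space_def disjnt_def by (simp flip: open_openin) (metis hausdorff)
  then show ?thesis by (rule Hausdorff_space_subtopology)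
qed

lemma continuum_top_of_set:
  fixes S :: "'a :: t2_space set"
  shows "continuum (top_of_set S) \<longleftrightarrow> compact S \<and> connected S \<and> (\<exists>x\<in>S. \<exists>y\<in>S. x \<noteq> y)"
proof -
  have "compact_space (top_of_set S) \<longleftrightarrow> compact S"
    using compactin_subspace[of euclidean S] by simp
  moreover have "connected_space (top_of_set S) \<longleftrightarrow> connected S"
    using connectedin_def[of euclidean S] by simp
  ultimately show ?thesis by (simp add: continuum_def Hausdorff_space_top_of_set)
qed

lemma subcontinuum_top_of_set:
  fixes S :: "'a :: t2_space set"
  shows "subcontinuum (top_of_set S) K \<longleftrightarrow>
    K \<subseteq> S \<and> compact K \<and> connected K \<and> (\<exists>x\<in>K. \<exists>y\<in>K. x \<noteq> y)"
  unfolding subcontinuum_def subtopology_subtopology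
  by (auto simp: Int_absorb1 continuum_top_of_set)

lemma interval_subset: "interval T a b \<subseteq> topspace T"
  by (auto simp: interval_def)

lemma interval_commute: "interval T a b = interval T b a"
  by (simp add: interval_def insert_commute)

lemma endpoints_in_interval:
  assumes "a \<in> topspace T" "b \<in> topspace T"
  shows "a \<in> interval T a b" "b \<in> interval T a b"
  using assms by (auto simp: interval_def)

lemma interval_least:
  fixes S :: "'a :: t2_space set"
  assumes "K \<subseteq> S" "compact K" "connected K" "a \<in> K" "b \<in> K" "a \<noteq> b"
  shows "interval (top_of_set S) a b \<subseteq> K"
  using assms by (auto simp: interval_def subcontinuum_top_of_set)

text \<open>Two-sided description of an interval: the candidate is itself a subcontinuum, hence contains
  the interval, and lies in every competing subcontinuum.  Every interval in the construction is
  computed in this way, and this is how intervals are shown to be connected, which an arbitrary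
  intersection of subcontinua need not be.\<close>

lemma interval_eqI:
  fixes S :: "'a :: t2_space set"
  assumes "I \<subseteq> S" "compact I" "connected I" "a \<in> I" "b \<in> I" "a \<noteq> b"
    and least: "\<And>K. K \<subseteq> S \<Longrightarrow> compact K \<Longrightarrow> connected K \<Longrightarrow> a \<in> K \<Longrightarrow> b \<in> K \<Longrightarrow> I \<subseteq> K"
  shows "interval (top_of_set S) a b = I"
proof
  show "interval (top_of_set S) a b \<subseteq> I" by (rule interval_least) (fact assms)+
  show "I \<subseteq> interval (top_of_set S) a b"
  proof
    fix x assume x: "x \<in> I"
    have "x \<in> K" if "subcontinuum (top_of_set S) K" "{a, b} \<subseteq> K" for K
      using least[of K] that x by (auto simp: subcontinuum_top_of_set)
    then show "x \<in> interval (top_of_set S) a b" using x assms(1) by (auto simp: interval_def)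
  qed
qed

lemma compact_interval:
  fixes S :: "'a :: t2_space set"
  assumes "compact S"
  shows "compact (interval (top_of_set S) a b)"
proof -
  have "interval (top_of_set S) a b =
      S \<inter> \<Inter> {K. subcontinuum (top_of_set S) K \<and> {a, b} \<subseteq> K}"
    by (auto simp: interval_def)
  moreover have "closed (\<Inter> {K. subcontinuum (top_of_set S) K \<and> {a, b} \<subseteq> K})"
    by (intro closed_Inter) (auto simp: subcontinuum_top_of_set compact_imp_closed)
  ultimately show ?thesis using assms by (metis compact_Int_closed)
qed

text \<open>Intervals are a topological notion, so they can be computed in any convenient model of a stage
  and carried over to the coded one.\<close>

lemma interval_homeomorphic_image:
  fixes S :: "'a :: t2_space set" and f :: "'a \<Rightarrow> 'b :: t2_space"
  assumes f: "continuous_on S f" and g: "continuous_on (f ` S) g"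
    and gf: "\<And>x. x \<in> S \<Longrightarrow> g (f x) = x" and ab: "a \<in> S" "b \<in> S"
  shows "interval (top_of_set (f ` S)) (f a) (f b) = f ` interval (top_of_set S) a b"
proof -
  have sub: "subcontinuum (top_of_set (h ` A)) (h ` K)"
    if "subcontinuum (top_of_set A) K" "continuous_on A h" "inj_on h A"
    for A :: "'c :: t2_space set" and h :: "'c \<Rightarrow> 'd :: t2_space" and K
  proof -
    have "K \<subseteq> A" "compact K" "connected K" "\<exists>x\<in>K. \<exists>y\<in>K. x \<noteq> y"
      using that(1) by (auto simp: subcontinuum_top_of_set)
    moreover have "continuous_on K h" "inj_on h K"
      using that(2,3) \<open>K \<subseteq> A\<close> by (auto intro: continuous_on_subset inj_on_subset)
    ultimately show ?thesis
      unfolding subcontinuum_top_of_set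
      by (auto simp: inj_on_eq_iff intro!: compact_continuous_image connected_continuous_image)
  qed
  have inj: "inj_on f S" "inj_on g (f ` S)" and S: "g ` f ` S = S"
    using gf by (auto simp: image_image intro: inj_on_inverseI)
  show ?thesis
  proof (intro equalityI subsetI)
    fix y assume y: "y \<in> interval (top_of_set (f ` S)) (f a) (f b)"
    then obtain x where x: "x \<in> S" "y = f x" by (auto simp: interval_def)
    have "x \<in> K" if K: "subcontinuum (top_of_set S) K" "{a, b} \<subseteq> K" for K
    proof -
      have "y \<in> f ` K" using y sub[OF K(1) f inj(1)] K(2) by (auto simp: interval_def)
      moreover have "K \<subseteq> S" using K(1) by (simp add: subcontinuum_top_of_set)
      ultimately show ?thesis using x(1,2) inj(1) by (auto dest!: inj_onD)
    qed
    then show "y \<in> f ` interval (top_of_set S) a b" using x by (auto simp: interval_def)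
  next
    fix y assume "y \<in> f ` interval (top_of_set S) a b"
    then obtain x where x: "x \<in> interval (top_of_set S) a b" "y = f x" by blast
    then have xS: "x \<in> S" by (auto simp: interval_def)
    have "y \<in> L" if L: "subcontinuum (top_of_set (f ` S)) L" "{f a, f b} \<subseteq> L" for L
    proof -
      have "subcontinuum (top_of_set S) (g ` L)" using sub[OF L(1) g inj(2)] S by simp
      moreover have "{a, b} \<subseteq> g ` L" using L(2) gf ab by force
      ultimately have "x \<in> g ` L" using x by (auto simp: interval_def)
      then obtain z where "z \<in> L" "x = g z" by blast
      moreover have "z \<in> f ` S" using L(1) \<open>z \<in> L\<close> by (auto simp: subcontinuum_top_of_set)
      ultimately show ?thesis using x(2) gf by auto
    qed
    then show "y \<in> interval (top_of_set (f ` S)) (f a) (f b)"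
      using x(2) xS by (auto simp: interval_def)
  qed
qed

text \<open>The compactness argument behind inverse limits.  If no member of the chain lay in \<open>W\<close>, the
  sets \<open>S - W\<close> would be a chain of nonempty compact sets and would have a common point.\<close>

lemma compact_chain_subset_open:
  fixes \<F> :: "'a :: t2_space set set"
  assumes "\<F> \<noteq> {}" and comp: "\<And>S. S \<in> \<F> \<Longrightarrow> compact S"
    and lin: "\<And>S T. S \<in> \<F> \<Longrightarrow> T \<in> \<F> \<Longrightarrow> S \<subseteq> T \<or> T \<subseteq> S"
    and W: "open W" "\<Inter>\<F> \<subseteq> W"
  shows "\<exists>S\<in>\<F>. S \<subseteq> W"
proof (rule ccontr)
  assume "\<not> ?thesis"
  then have ne: "S - W \<noteq> {}" if "S \<in> \<F>" for S using that by blast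
  obtain K where K: "K \<in> \<F>" using assms(1) by blast
  have "(K - W) \<inter> \<Inter>\<F> \<noteq> {}"
  proof (rule compact_imp_fip)
    show "compact (K - W)" using comp[OF K] W(1) by (rule compact_diff)
    show "closed T" if "T \<in> \<F>" for T using comp[OF that] by (rule compact_imp_closed)
    show "(K - W) \<inter> \<Inter>F \<noteq> {}" if F: "finite F" "F \<subseteq> \<F>" for F
    proof -
      obtain M where M: "M \<in> insert K F" "\<And>T. T \<in> insert K F \<Longrightarrow> T \<subseteq> M \<Longrightarrow> M = T"
        using finite_has_minimal[of "insert K F"] F by auto
      then have "M \<subseteq> T" if "T \<in> insert K F" for T
        using lin[of M T] that F K by blast
      then show ?thesis using ne[of M] M(1) F K by blast
    qed
  qed
  then show False using W(2) by blast
qed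

text \<open>A separation of the intersection extends to disjoint open sets, whose union already contains
  some member of the chain, and so it separates that member.\<close>

lemma connected_compact_chain:
  fixes \<F> :: "'a :: t2_space set set"
  assumes "\<F> \<noteq> {}" and cc: "\<And>S. S \<in> \<F> \<Longrightarrow> compact S \<and> connected S"
    and lin: "\<And>S T. S \<in> \<F> \<Longrightarrow> T \<in> \<F> \<Longrightarrow> S \<subseteq> T \<or> T \<subseteq> S"
  shows "connected (\<Inter>\<F>)"
proof -
  have cl: "closed (\<Inter>\<F>)" using cc by (intro closed_Inter) (auto simp: compact_imp_closed)
  obtain K where K: "K \<in> \<F>" using assms(1) by blast
  show ?thesis
  proof (rule ccontr)
    assume "\<not> ?thesis"
    then obtain A B where AB: "closed A" "closed B" "A \<noteq> {}" "B \<noteq> {}" "A \<union> B = \<Inter>\<F>" "A \<inter> B = {}"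
      unfolding connected_closed_set[OF cl] by blast
    have "A = K \<inter> A" "B = K \<inter> B" using AB(5) K by blast+
    then have "compact A" "compact B" using cc[OF K] AB(1,2) by (metis compact_Int_closed)+
    then obtain U V where UV: "open U" "open V" "A \<subseteq> U" "B \<subseteq> V" "disjnt U V"
      using Hausdorff_space_compact_separation[of "top_of_set (UNIV :: 'a set)" A B]
        Hausdorff_space_top_of_set[of "UNIV :: 'a set"] AB(6)
      by (auto simp: disjnt_def)
    have "\<exists>S\<in>\<F>. S \<subseteq> U \<union> V"
    proof (rule compact_chain_subset_open)
      show "\<Inter>\<F> \<subseteq> U \<union> V" using UV(3,4) AB(5) by blast
    qed (use assms(1) cc lin UV in auto)
    then obtain S where S: "S \<in> \<F>" "S \<subseteq> U \<union> V" by blast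
    moreover have "A \<subseteq> S" "B \<subseteq> S" using AB(5) S(1) by blast+
    ultimately show False
      using connectedD[of S U V] cc[OF S(1)] UV AB(3,4) unfolding disjnt_def by blast
  qed
qed

section \<open>Spirals\<close>

text \<open>A successor stage is an infinite staircase over the previous stage \<open>X\<close> that descends to
  \<open>X \<times> {0}\<close>.  Numbering the levels \<open>1, 1/2, 1/3, \<dots>\<close> consecutively, instead of in the pairs
  \<open>1/(2n-1), 1/(2n)\<close>, and writing \<open>c m\<close> for the sequence \<open>a, q\<^sup>1, a, q\<^sup>2, a, \<dots>\<close>, the copy of
  \<open>X\<close> at level number \<open>m\<close> is crossed along the interval from \<open>c m\<close> to \<open>c (m + 1)\<close>, and
  a vertical arc over \<open>c (m + 1)\<close> leads down to the next level.  This removes the distinction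
  between odd and even levels.\<close>

definition height :: "nat \<Rightarrow> real" where "height m = 1 / (real m + 1)"

lemma height_0 [simp]: "height 0 = 1"
  by (simp add: height_def)

lemma height_pos [simp]: "0 < height m"
  by (simp add: height_def)

lemma height_less_iff [simp]: "height m < height n \<longleftrightarrow> n < m"
  by (simp add: height_def divide_simps)

lemma height_le_iff [simp]: "height m \<le> height n \<longleftrightarrow> n \<le> m"
  by (simp add: height_def divide_simps)

lemma height_eq_iff [simp]: "height m = height n \<longleftrightarrow> m = n"
  by (auto simp: height_def divide_simps)

lemma height_neq_0 [simp]: "height m \<noteq> 0"
  by (metis height_pos less_irrefl)

lemma height_le_1 [simp]: "height m \<le> 1"
  by (simp add: height_def divide_simps)

lemma height_tendsto_0: "height \<longlonglongrightarrow> 0"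
  using LIMSEQ_inverse_real_of_nat unfolding height_def by (simp add: inverse_eq_divide add.commute)

lemma height_eventually_less:
  assumes "0 < t"
  obtains n where "height n < t"
  using eventually_happens[OF order_tendstoD(2)[OF height_tendsto_0 assms]] by auto

locale spiral =
  fixes X :: "'a :: t2_space set" and c :: "nat \<Rightarrow> 'a"
  assumes compact_base: "compact X"
    and corner_in: "c m \<in> X"
    and corners_differ: "c m \<noteq> c (Suc m)"
    and connected_interval: "connected (interval (top_of_set X) (c m) (c (Suc m)))"
begin

definition rung :: "nat \<Rightarrow> 'a set" where
  "rung m = interval (top_of_set X) (c m) (c (Suc m))"

definition turn :: "nat \<Rightarrow> ('a \<times> real) set" where
  "turn m = rung m \<times> {height m} \<union> {c (Suc m)} \<times> {height (Suc m)..height m}"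

definition total :: "('a \<times> real) set" where
  "total = X \<times> {0} \<union> (\<Union>m. turn m)"

definition tail :: "nat \<Rightarrow> ('a \<times> real) set" where
  "tail n = {z \<in> total. height n \<le> snd z}"

lemma rung_subset: "rung m \<subseteq> X"
  using interval_subset[of "top_of_set X"] by (simp add: rung_def)

lemma corner_in_rung: "c m \<in> rung m" "c (Suc m) \<in> rung m"
  unfolding rung_def by (rule endpoints_in_interval; simp add: corner_in)+

lemma compact_rung: "compact (rung m)"
  unfolding rung_def using compact_base by (rule compact_interval)

lemma connected_rung: "connected (rung m)"
  unfolding rung_def by (rule connected_interval)

lemma rung_least:
  assumes "K \<subseteq> X" "compact K" "connected K" "c m \<in> K" "c (Suc m) \<in> K"
  shows "rung m \<subseteq> K"
  unfolding rung_def using assms corners_differ[of m] by (intro interval_least)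

lemma compact_turn: "compact (turn m)"
  unfolding turn_def by (intro compact_Un compact_Times compact_rung) auto

lemma connected_turn: "connected (turn m)"
  unfolding turn_def
proof (intro connected_Un connected_Times connected_rung)
  show "rung m \<times> {height m} \<inter> {c (Suc m)} \<times> {height (Suc m)..height m} \<noteq> {}"
    using corner_in_rung(2)[of m] by (auto simp: disjoint_iff less_imp_le)
qed auto

lemma corner_in_turn: "(c m, height m) \<in> turn m" "(c (Suc m), height (Suc m)) \<in> turn m"
    "(c (Suc m), height m) \<in> turn m"
  using corner_in_rung by (auto simp: turn_def)

lemma turn_height:
  assumes "(x, t) \<in> turn m"
  shows "height (Suc m) \<le> t" "t \<le> height m"
  using assms by (auto simp: turn_def)

lemma turn_subset: "turn m \<subseteq> X \<times> {height (Suc m)..height m}"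
  using rung_subset corner_in by (auto simp: turn_def)

lemma connected_turns: "connected (\<Union>m<n. turn m)"
proof (induction n)
  case (Suc n)
  have "(\<Union>m<n. turn m) \<inter> turn n \<noteq> {}" if "n \<noteq> 0"
    using that corner_in_turn(2)[of "n - 1"] corner_in_turn(1)[of n] by fastforce
  then show ?case
    using connected_Un[OF Suc connected_turn[of n]] connected_turn[of n]
    by (cases "n = 0") (auto simp: lessThan_Suc Un_commute)
qed simp

lemma fiber_between:
  assumes "(x, t) \<in> total" "height (Suc m) < t" "t < height m"
  shows "x = c (Suc m)"
proof -
  have "t \<noteq> 0" using assms(2) height_pos[of "Suc m"] by linarith
  then obtain k where k: "(x, t) \<in> turn k" using assms by (auto simp: total_def)
  have "height (Suc m) < height k" "height (Suc k) < height m"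
    using turn_height[OF k] assms(2,3) by linarith+
  then have "k = m" by simp
  then show ?thesis using k assms(3) by (auto simp: turn_def)
qed

lemma total_subset: "total \<subseteq> X \<times> {0..1}"
proof -
  have "turn m \<subseteq> X \<times> {0..1}" for m
  proof -
    have "{height (Suc m)..height m} \<subseteq> {0..1}" by (simp add: less_imp_le)
    then show ?thesis using turn_subset[of m] by blast
  qed
  then show ?thesis by (auto simp: total_def)
qed

text \<open>Finitely many turns together with a cylinder over \<open>X\<close> of vanishing height form compact sets
  that decrease to the spiral.\<close>

lemma compact_total: "compact total"
proof -
  define A where "A n = (\<Union>m<n. turn m) \<union> X \<times> {0..height n}" for n
  have A: "compact (A n)" for n
    unfolding A_def by (intro compact_Un compact_UN compact_Times compact_base compact_turn) auto
  have "total = (\<Inter>n. A n)"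
  proof (intro equalityI subsetI INT_I)
    fix z n assume z: "z \<in> total"
    show "z \<in> A n"
    proof (cases "z \<in> (\<Union>m<n. turn m)")
      case False
      then have "z \<in> X \<times> {0} \<or> (\<exists>m\<ge>n. z \<in> turn m)" using z by (auto simp: total_def not_less[symmetric])
      then show ?thesis
      proof
        assume "\<exists>m\<ge>n. z \<in> turn m"
        then obtain m where m: "n \<le> m" "z \<in> turn m" by blast
        then have "snd z \<le> height m" "fst z \<in> X" "0 \<le> snd z"
          using turn_subset[of m] z total_subset by auto
        then show ?thesis using order_trans[of "snd z" "height m" "height n"] m(1)
          by (cases z) (auto simp: A_def)
      qed (auto simp: A_def less_imp_le)
    qed (simp add: A_def)
  next
    fix z assume z: "z \<in> (\<Inter>n. A n)"
    show "z \<in> total"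
    proof (rule ccontr)
      assume nz: "z \<notin> total"
      then have zX: "z \<in> X \<times> {0..height n}" for n using z by (auto simp: A_def total_def)
      have "\<not> 0 < snd z"
      proof
        assume "0 < snd z"
        then obtain n where "height n < snd z" by (rule height_eventually_less)
        then show False using zX[of n] by auto
      qed
      then have "z \<in> X \<times> {0}" using zX[of 0] by auto
      then show False using nz by (simp add: total_def)
    qed
  qed
  then show ?thesis
    using A compact_Int_closed[OF A[of 0], of "\<Inter>n. A n"]
    by (simp add: closed_INT compact_imp_closed Int_absorb1 INF_lower)
qed

text \<open>The turns form a connected set; the points over \<open>c 0\<close> at every other level converge to a point
  of \<open>X \<times> {0}\<close>, which glues the two parts together.\<close>

lemma connected_total:
  assumes "connected X" and c: "\<And>m. c (2 * m) = c 0"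
  shows "connected total"
proof -
  let ?R = "\<Union>m. turn m"
  have "?R = \<Union> (range (\<lambda>n. \<Union>m<Suc n. turn m))" by auto
  moreover have "connected (\<Union> (range (\<lambda>n. \<Union>m<Suc n. turn m)))"
  proof (rule connected_Union)
    show "\<Inter> (range (\<lambda>n. \<Union>m<Suc n. turn m)) \<noteq> {}"
      using corner_in_turn(1)[of 0] by blast
  qed (use connected_turns in blast)
  ultimately have R: "connected ?R" by simp
  have "(\<lambda>m. (c 0, height (2 * m))) \<longlonglongrightarrow> (c 0, 0)"
    by (intro tendsto_Pair tendsto_const
        LIMSEQ_subseq_LIMSEQ[OF height_tendsto_0, of "\<lambda>m. 2 * m", unfolded o_def])
      (simp add: strict_mono_def)
  moreover have "(c 0, height (2 * m)) \<in> closure ?R" for m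
    using corner_in_turn(1)[of "2 * m"] c[of m] by (intro subsetD[OF closure_subset]) auto
  ultimately have "(c 0, 0) \<in> closure ?R"
    by (rule Lim_in_closed_set[OF closed_closure always_eventually[OF allI] trivial_limit_sequentially, rotated])
  then have "insert (c 0, 0) ?R \<subseteq> closure ?R" using closure_subset[of ?R] by blast
  then have "connected (insert (c 0, 0) ?R)"
    by (rule connected_intermediate_closure[OF R subset_insertI])
  then have "connected (X \<times> {0} \<union> insert (c 0, 0) ?R)"
    using assms(1) corner_in by (intro connected_Un connected_Times) auto
  moreover have "X \<times> {0} \<union> insert (c 0, 0) ?R = total" using corner_in by (auto simp: total_def)
  ultimately show ?thesis by simp
qed

lemma tail_eq: "tail n = (\<Union>m<n. turn m) \<union> rung n \<times> {height n}"
proof (intro equalityI subsetI)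
  fix z assume z: "z \<in> tail n"
  then have "z \<in> total" "height n \<le> snd z" by (auto simp: tail_def)
  moreover have "snd z \<noteq> 0" using height_pos[of n] calculation by linarith
  ultimately obtain m where m: "z \<in> turn m" by (auto simp: total_def)
  then have "height n \<le> height m" using order_trans[OF \<open>height n \<le> snd z\<close> turn_height(2)[of "fst z"]] by simp
  then consider "m < n" | "m = n" by fastforce
  then show "z \<in> (\<Union>m<n. turn m) \<union> rung n \<times> {height n}"
  proof cases
    case 2
    then show ?thesis using m \<open>height n \<le> snd z\<close> corner_in_rung by (auto simp: turn_def)
  qed (use m in blast)
next
  fix z assume "z \<in> (\<Union>m<n. turn m) \<union> rung n \<times> {height n}"
  then consider m where "m < n" "z \<in> turn m" | "z \<in> rung n \<times> {height n}" by blast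
  then show "z \<in> tail n"
  proof cases
    case 1
    then have "height n \<le> height (Suc m)" by simp
    then have "height n \<le> snd z" using turn_height(1)[of "fst z" "snd z" m] 1(2)
      by (simp del: height_le_iff)
    then show ?thesis using 1(2) by (auto simp: tail_def total_def)
  qed (auto simp: tail_def total_def turn_def)
qed

lemma tail_over_rung:
  assumes "z \<in> tail n"
  obtains m where "m \<le> n" "fst z \<in> rung m"
proof -
  have "fst z \<in> rung m" if "z \<in> turn m" for m
    using that corner_in_rung(2)[of m] by (auto simp: turn_def)
  moreover have "(\<exists>m<n. z \<in> turn m) \<or> fst z \<in> rung n" using assms by (auto simp: tail_eq)
  ultimately show ?thesis using that by (meson less_imp_le order_refl)
qed

lemma compact_tail: "compact (tail n)"
  unfolding tail_eq by (intro compact_Un compact_UN compact_Times compact_turn compact_rung) auto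

lemma connected_tail: "connected (tail n)"
proof (cases n)
  case 0
  then show ?thesis by (auto simp: tail_eq intro!: connected_Times connected_rung)
next
  case (Suc k)
  then have "(\<Union>m<n. turn m) \<inter> rung n \<times> {height n} \<noteq> {}"
    using corner_in_turn(2)[of k] corner_in_rung(1)[of n] by auto
  then show ?thesis
    unfolding tail_eq by (intro connected_Un connected_turns connected_Times connected_rung) auto
qed

text \<open>The slice is the image of \<open>K\<close> under a continuous map to \<open>X\<close>: everything above the level
  collapses to \<open>c m\<close>, everything below it to \<open>c (m + 1)\<close>.  The map is continuous because next to
  the level the spiral consists only of the vertical arcs over these two points.  This
  replaces any appeal to hereditary unicoherence.\<close>

lemma slice_of_connected:
  assumes K: "K \<subseteq> total" "connected K" "(c m, height m) \<in> K" "(c (Suc m), height m) \<in> K"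
  shows "connected {x. (x, height m) \<in> K}"
proof -
  obtain l where l: "height (Suc m) < l" "l < height m"
    using dense[of "height (Suc m)" "height m"] by auto
  obtain u where u: "height m < u" "m \<noteq> 0 \<Longrightarrow> u < height (m - 1)"
  proof (cases "m = 0")
    case True
    then show ?thesis using that[of 2] by simp
  next
    case False
    then show ?thesis using that dense[of "height m" "height (m - 1)"] by auto
  qed
  have low: "x = c (Suc m)" if "(x, t) \<in> K" "l \<le> t" "t < height m" for x t
    using fiber_between[of x t m] that K(1) l by auto
  have high: "x = c m" if "(x, t) \<in> K" "height m < t" "t \<le> u" for x t
  proof (cases m)
    case 0
    then show ?thesis using that K(1) total_subset by fastforce
  next
    case (Suc k)
    then show ?thesis using fiber_between[of x t k] that K(1) u by auto
  qed
  \<comment> \<open>Between the heights \<open>l\<close> and \<open>u\<close> the map is the projection, which on the two arcs is already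
    the required constant; so only closed pieces have to be pasted.\<close>
  let ?r = "\<lambda>z. if snd z \<le> l then c (Suc m) else if snd z \<le> u then fst z else c m"
  let ?S = "{x. (x, height m) \<in> K}"
  have "continuous_on K ?r"
  proof (intro continuous_on_cases_le continuous_on_const continuous_on_fst continuous_on_snd continuous_on_id)
    show "c (Suc m) = (if snd z \<le> u then fst z else c m)" if "z \<in> K" "snd z = l" for z
      using that low[of "fst z" l] l u(1) by auto
    show "fst z = c m" if "z \<in> {z \<in> K. l \<le> snd z}" "snd z = u" for z
      using that high[of "fst z" u] u(1) by auto
  qed
  then have "connected (?r ` K)" using K(2) by (rule connected_continuous_image)
  moreover have "?r ` K = ?S"
  proof (intro equalityI subsetI)
    fix y assume "y \<in> ?r ` K"
    then obtain x t where xt: "(x, t) \<in> K" "y = ?r (x, t)" by auto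
    consider "t \<le> l" | "l < t" "t < height m" | "t = height m" | "height m < t" "t \<le> u" | "u < t"
      by linarith
    then show "y \<in> ?S"
      using xt low[OF xt(1)] high[OF xt(1)] K(3,4) l u(1) by cases auto
  next
    fix x assume "x \<in> ?S"
    then show "x \<in> ?r ` K" using l u(1) by (intro image_eqI[of _ _ "(x, height m)"]) auto
  qed
  ultimately show ?thesis by simp
qed

text \<open>A connected set reaching from height \<open>1\<close> down to \<open>height n\<close> meets all heights in between, so it
  contains the vertical arcs, over which the fibers are single points.  It therefore joins the two
  ends of every rung passed, and the slice at that rung is a subcontinuum of \<open>X\<close> containing the
  interval between them.\<close>

lemma tail_least:
  assumes K: "K \<subseteq> total" "compact K" "connected K" "(c 0, height 0) \<in> K" "(c (Suc n), height n) \<in> K"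
  shows "tail n \<subseteq> K"
proof -
  have heights: "t \<in> snd ` K" if "height n \<le> t" "t \<le> height 0" for t
  proof -
    have "connected (snd ` K)" using K(3) by (intro connected_continuous_image continuous_intros)
    then have "is_interval (snd ` K)" by (simp add: is_interval_connected_1)
    moreover have "height n \<in> snd ` K" "height 0 \<in> snd ` K" using K(4,5) by force+
    ultimately show ?thesis using that by (meson mem_is_interval_1_I)
  qed
  have arc: "{c (Suc m)} \<times> {height (Suc m)..height m} \<subseteq> K" if m: "m < n" for m
  proof -
    have "t \<in> Pair (c (Suc m)) -` K" if t: "t \<in> {height (Suc m)<..<height m}" for t
    proof -
      have "height n \<le> height (Suc m)" "height m \<le> height 0" using m by (simp_all del: height_0)
      then have "height n \<le> t" "t \<le> height 0" using t by (auto simp del: height_0 height_le_iff)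
      then obtain x where x: "(x, t) \<in> K" using heights[of t] by force
      then have "x = c (Suc m)" using fiber_between[of x t m] t K(1) by auto
      then show ?thesis using x by simp
    qed
    moreover have "closed (Pair (c (Suc m)) -` K)"
      using compact_imp_closed[OF K(2)] by (intro closed_vimage continuous_intros) 
    ultimately have "closure {height (Suc m)<..<height m} \<subseteq> Pair (c (Suc m)) -` K"
      by (intro closure_minimal) auto
    then show ?thesis by (auto simp: closure_greaterThanLessThan)
  qed
  have level: "rung m \<times> {height m} \<subseteq> K" if m: "m \<le> n" for m
  proof -
    have 1: "(c m, height m) \<in> K"
    proof (cases m)
      case (Suc k)
      then show ?thesis using arc[of k] m by auto
    qed (use K(4) in simp)
    have 2: "(c (Suc m), height m) \<in> K"
      using arc[of m] m K(5) by (cases "m = n") auto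
    have "rung m \<subseteq> {x. (x, height m) \<in> K}"
    proof (rule rung_least)
      show "{x. (x, height m) \<in> K} \<subseteq> X" using K(1) total_subset by auto
      have "{x. (x, height m) \<in> K} = fst ` (K \<inter> UNIV \<times> {height m})" by force
      then show "compact {x. (x, height m) \<in> K}"
        using K(2) by (auto intro!: compact_continuous_image continuous_intros compact_Int_closed closed_Times)
      show "connected {x. (x, height m) \<in> K}" using slice_of_connected K(1,3) 1 2 by blast
    qed (use 1 2 in auto)
    then show ?thesis by auto
  qed
  have "turn m \<subseteq> K" if "m < n" for m
    using arc[OF that] level[of m] that by (simp add: turn_def)
  then show ?thesis using level[of n] by (auto simp: tail_eq)
qed

lemma interval_total:
  "interval (top_of_set total) (c 0, height 0) (c (Suc n), height n) = tail n"
proof (rule interval_eqI)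
  show "tail n \<subseteq> total" by (auto simp: tail_def)
  show "(c 0, height 0) \<in> tail n"
    using corner_in_turn(1)[of 0] height_le_iff[of n 0] by (auto simp: tail_def total_def)
  show "(c (Suc n), height n) \<in> tail n" using corner_in_rung by (simp add: tail_eq)
  show "(c 0, height 0) \<noteq> (c (Suc n), height n)"
    using corners_differ[of 0] height_eq_iff[of 0 n] by auto
qed (use compact_tail connected_tail tail_least in auto)

end

section \<open>The first stage\<close>

lemma continuous_on_topologist_sine: "continuous_on {..<0} (\<lambda>x :: real. (x, sin (1 / x)))"
  by (intro continuous_intros) auto

definition sine_arc :: "real \<Rightarrow> (real \<times> real) set" where
  "sine_arc u = (\<lambda>x. (x, sin (1 / x))) ` {- 2 / pi..u}"

lemma compact_connected_sine_arc:
  assumes "u < 0"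
  shows "compact (sine_arc u)" "connected (sine_arc u)"
proof -
  have c: "continuous_on {- 2 / pi..u} (\<lambda>x :: real. (x, sin (1 / x)))"
    using continuous_on_topologist_sine by (rule continuous_on_subset) (use assms in auto)
  show "compact (sine_arc u)" "connected (sine_arc u)"
    unfolding sine_arc_def
    using compact_continuous_image[OF c] connected_continuous_image[OF c] by auto
qed

lemma sine_arc_subset: "u < 0 \<Longrightarrow> sine_arc u \<subseteq> sin_curve"
  by (auto simp: sine_arc_def sin_curve_def)

lemma sin_curve_fiber: "(x, y) \<in> sin_curve \<Longrightarrow> x < 0 \<Longrightarrow> y = sin (1 / x)"
  by (auto simp: sin_curve_def)

text \<open>A connected subset of the curve projects onto an interval of the first axis, and over negative
  abscissae the curve is a graph; so such a subset contains the whole arc between two of its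
  points on the graph.\<close>

lemma interval_sin_curve:
  assumes "- 2 / pi < u" "u < 0"
  shows "interval (top_of_set sin_curve) (- 2 / pi, -1) (u, sin (1 / u)) = sine_arc u"
proof (rule interval_eqI)
  have "sin (1 / (- 2 / pi)) = (-1 :: real)" by (simp add: divide_simps)
  then show "(- 2 / pi, -1) \<in> sine_arc u"
    unfolding sine_arc_def using assms by (intro image_eqI[of _ _ "- 2 / pi"]) auto
  show "(u, sin (1 / u)) \<in> sine_arc u" using assms by (auto simp: sine_arc_def)
  fix K assume K: "K \<subseteq> sin_curve" "connected K" "(- 2 / pi, -1) \<in> K" "(u, sin (1 / u)) \<in> K"
  have "connected (fst ` K)" using K(2) by (intro connected_continuous_image continuous_intros)
  then have I: "is_interval (fst ` K)" by (simp add: is_interval_connected_1)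
  have ends: "- 2 / pi \<in> fst ` K" "u \<in> fst ` K" using K(3,4) by force+
  show "sine_arc u \<subseteq> K"
  proof
    fix z assume "z \<in> sine_arc u"
    then obtain x where x: "z = (x, sin (1 / x))" "- 2 / pi \<le> x" "x \<le> u"
      by (auto simp: sine_arc_def)
    then obtain y where "(x, y) \<in> K" using mem_is_interval_1_I[OF I ends] by force
    then show "z \<in> K" using sin_curve_fiber[of x y] K(1) x assms(2) by auto
  qed
qed (use assms compact_connected_sine_arc sine_arc_subset in auto)

lemma compact_sin_curve: "compact sin_curve"
proof -
  define A where "A n = sine_arc (- height n) \<union> {- height n..0} \<times> {-1..1}" for n
  have A: "compact (A n)" for n
    unfolding A_def by (intro compact_Un compact_Times compact_connected_sine_arc) auto
  have "sin_curve = (\<Inter>n. A n)"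
  proof (intro equalityI subsetI INT_I)
    fix z n assume "z \<in> sin_curve"
    then show "z \<in> A n"
      by (auto simp: sin_curve_def A_def sine_arc_def less_imp_le)
  next
    fix z assume z: "z \<in> (\<Inter>n. A n)"
    obtain x y where xy: "z = (x, y)" by (cases z)
    have neg: "t < 0" if "t \<le> - height n" for t n using that height_pos[of n] by linarith
    have 0: "(x, y) \<in> A 0" using z xy by blast
    then have "x \<le> 0" "y \<in> {-1..1}" by (auto simp: A_def sine_arc_def)
    show "z \<in> sin_curve"
    proof (cases "x = 0")
      case True
      then show ?thesis using \<open>y \<in> {-1..1}\<close> xy by (auto simp: sin_curve_def)
    next
      case False
      then obtain n where "height n < - x" using \<open>x \<le> 0\<close> height_eventually_less[of "- x"] by auto
      moreover have "(x, y) \<in> A n" using z xy by blast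
      ultimately show ?thesis using xy neg \<open>x \<noteq> 0\<close> \<open>x \<le> 0\<close> by (auto simp: A_def sine_arc_def sin_curve_def)
    qed
  qed
  moreover have "closed (\<Inter>n. A n)" using A by (intro closed_INT) (auto intro: compact_imp_closed)
  ultimately have "closed sin_curve" "A 0 \<inter> sin_curve = sin_curve" by auto
  then show ?thesis using compact_Int_closed[OF A[of 0]] by metis
qed

lemma connected_sin_curve: "connected sin_curve"
proof -
  let ?G = "(\<lambda>x :: real. (x, sin (1 / x))) ` {- 2 / pi..<0}"
  have "connected ?G"
    by (intro connected_continuous_image continuous_on_subset[OF continuous_on_topologist_sine]) auto
  moreover have "?G \<subseteq> sin_curve" by (auto simp: sin_curve_def)
  moreover have "sin_curve \<subseteq> closure ?G"
  proof
    fix z assume "z \<in> sin_curve"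
    then consider "z \<in> ?G" | y where "z = (0, y)" "-1 \<le> y" "y \<le> 1"
      by (auto simp: sin_curve_def)
    then show "z \<in> closure ?G"
    proof cases
      case (2 y)
      \<comment> \<open>The abscissae \<open>-1 / s k\<close> tend to \<open>0\<close> from the left, and at each of them the graph has
        height \<open>y\<close>.\<close>
      define s where "s k = 2 * pi * real (Suc k) - arcsin y" for k
      have "sin (2 * pi * real (Suc k)) = 0" "cos (2 * pi * real (Suc k)) = 1" for k
        using sin_npi2[of "2 * Suc k"] cos_npi2[of "2 * Suc k"] by (simp_all add: mult_ac)
      then have sin_s: "sin (- s k) = y" for k
        using 2 sin_diff[of "arcsin y" "2 * pi * real (Suc k)"] by (simp add: s_def)
      have s: "pi / 2 + real k \<le> s k" for k
      proof -
        have "arcsin y \<le> pi / 2" using arcsin_ubound 2 by simp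
        moreover have "1 * real k \<le> (2 * pi) * real k"
          using pi_ge_two by (intro mult_right_mono) auto
        moreover have "s k = 2 * pi + 2 * pi * real k - arcsin y" by (simp add: s_def algebra_simps)
        ultimately show ?thesis using pi_ge_two by linarith
      qed
      have "filterlim s at_top sequentially"
        using filterlim_real_sequentially
        by (rule filterlim_at_top_mono) (use s pi_ge_two in \<open>auto intro!: always_eventually order_trans[OF _ s]\<close>)
      then have "(\<lambda>k. - inverse (s k)) \<longlonglongrightarrow> - 0"
        by (intro tendsto_minus tendsto_inverse_0_at_top)
      then have "(\<lambda>k. (- inverse (s k), y)) \<longlonglongrightarrow> (0, y)"
        by (intro tendsto_Pair tendsto_const) simp
      moreover have "(- inverse (s k), y) \<in> closure ?G" for k
      proof -
        have "0 < s k" "pi / 2 \<le> s k" using s[of k] pi_ge_two by linarith+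
        then have "inverse (s k) \<le> inverse (pi / 2)" by (intro le_imp_inverse_le) auto
        then have "- inverse (s k) \<in> {- 2 / pi..<0}" using \<open>0 < s k\<close> by simp
        then have "(- inverse (s k), y) \<in> ?G"
          using sin_s[of k] by (intro image_eqI[of _ _ "- inverse (s k)"]) (auto simp: inverse_eq_divide)
        then show ?thesis by (rule subsetD[OF closure_subset])
      qed
      ultimately show ?thesis
        unfolding 2(1)
        by (rule Lim_in_closed_set[OF closed_closure always_eventually[OF allI] trivial_limit_sequentially, rotated])
    next
      case 1
      then show ?thesis by (rule subsetD[OF closure_subset])
    qed
  qed
  ultimately show ?thesis by (rule connected_intermediate_closure)
qed

section \<open>Inverse limits in coordinates\<close>

text \<open>If \<open>\<beta> \<le> \<alpha>\<close> and the points of \<open>C\<close> have no nonzero coordinates from \<open>\<beta>\<close> on, this is a copy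
  of \<open>C \<times> [0, 1]\<^bsup>[\<beta>, \<alpha>)\<^esup>\<close>.  An inverse limit of sets \<open>C \<beta>\<close> is the intersection of
  the decreasing family of these cylinders, so that the chain lemmas apply although the sets
  \<open>C \<beta>\<close> themselves are not nested.\<close>

definition cylinder :: "ordinal \<Rightarrow> ordinal \<Rightarrow> point set \<Rightarrow> point set" where
  "cylinder \<alpha> \<beta> C = {x. bond \<alpha> x = x \<and> (\<forall>\<gamma>. snd x \<gamma> \<in> {0..1}) \<and> bond \<beta> x \<in> C}"

lemma bond_eq_iff: "bond \<alpha> x = x \<longleftrightarrow> (\<forall>\<gamma>\<ge>\<alpha>. snd x \<gamma> = 0)"
  by (auto simp: bond_def prod_eq_iff fun_eq_iff not_less)

lemma compact_connected_cylinder: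
  assumes "\<beta> \<le> \<alpha>" "compact C" "connected C"
    and C: "\<And>x. x \<in> C \<Longrightarrow> bond \<beta> x = x" "\<And>x \<gamma>. x \<in> C \<Longrightarrow> snd x \<gamma> \<in> {0..1}"
  shows "compact (cylinder \<alpha> \<beta> C)" "connected (cylinder \<alpha> \<beta> C)"
proof -
  define P :: "(ordinal \<Rightarrow> real) set" where
    "P = (\<Pi>\<^sub>E \<gamma>\<in>UNIV. if \<gamma> < \<alpha> then {0..1} else {0})"
  define h :: "point \<times> (ordinal \<Rightarrow> real) \<Rightarrow> point" where
    "h z = (fst (fst z), \<lambda>\<gamma>. if \<gamma> < \<beta> then snd (fst z) \<gamma> else snd z \<gamma>)" for z
  have P: "compact P" "connected P"
    unfolding P_def
    using compactin_PiE[of "\<lambda>_. euclideanreal" "UNIV :: ordinal set"]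
      connectedin_PiE[of "\<lambda>_. euclideanreal" "UNIV :: ordinal set"]
    by (auto simp: euclidean_product_topology)
  have h: "continuous_on S h" for S
  proof (rule continuous_on_point)
    show "continuous_on S (\<lambda>z. snd (h z) \<gamma>)" for \<gamma>
      by (cases "\<gamma> < \<beta>") (auto simp: h_def intro!: continuous_on_coord continuous_intros
          continuous_on_product_then_coordinatewise[OF continuous_on_snd])
  qed (auto simp: h_def intro!: continuous_intros)
  have "cylinder \<alpha> \<beta> C = h ` (C \<times> P)"
  proof (intro equalityI subsetI)
    fix x assume x: "x \<in> cylinder \<alpha> \<beta> C"
    then have "snd x \<in> P"
      by (auto simp: cylinder_def P_def bond_eq_iff)
    moreover have "h (bond \<beta> x, snd x) = x"
      by (auto simp: h_def bond_def prod_eq_iff)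
    ultimately show "x \<in> h ` (C \<times> P)"
      using x by (intro image_eqI[of _ _ "(bond \<beta> x, snd x)"]) (auto simp: cylinder_def)
  next
    fix x assume "x \<in> h ` (C \<times> P)"
    then obtain y f where y: "y \<in> C" "f \<in> P" "x = h (y, f)" by auto
    have f: "f \<gamma> \<in> (if \<gamma> < \<alpha> then {0..1} else {0})" for \<gamma>
      using y(2) by (auto simp: P_def PiE_iff)
    have "bond \<beta> x = bond \<beta> y" using y(3) by (auto simp: h_def bond_def)
    then have "bond \<beta> x \<in> C" using C(1) y(1) by simp
    moreover have "snd x \<gamma> \<in> {0..1}" for \<gamma>
      using y(1,3) C(2)[of y \<gamma>] f[of \<gamma>] by (auto simp: h_def split: if_splits)
    moreover have "snd x \<gamma> = 0" if "\<gamma> \<ge> \<alpha>" for \<gamma>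
      using y(3) f[of \<gamma>] leD[OF that] leD[OF order_trans[OF assms(1) that]]
      by (simp add: h_def)
    ultimately show "x \<in> cylinder \<alpha> \<beta> C" by (auto simp: cylinder_def bond_eq_iff)
  qed
  then show "compact (cylinder \<alpha> \<beta> C)" "connected (cylinder \<alpha> \<beta> C)"
    using compact_continuous_image[OF h] connected_continuous_image[OF h]
      compact_Times[OF assms(2) P(1)] connected_Times[OF assms(3) P(2)] by auto
qed

lemma compact_connected_inverse_limit:
  assumes \<alpha>: "olimit \<alpha>"
    and C: "\<And>\<beta>. \<beta> < \<alpha> \<Longrightarrow> compact (C \<beta>)" "\<And>\<beta>. \<beta> < \<alpha> \<Longrightarrow> connected (C \<beta>)"
    and fixed: "\<And>\<beta> x. \<beta> < \<alpha> \<Longrightarrow> x \<in> C \<beta> \<Longrightarrow> bond \<beta> x = x"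
    and unit: "\<And>\<beta> x \<gamma>. \<beta> < \<alpha> \<Longrightarrow> x \<in> C \<beta> \<Longrightarrow> snd x \<gamma> \<in> {0..1}"
    and bonds: "\<And>\<beta> \<gamma> x. \<gamma> \<le> \<beta> \<Longrightarrow> \<beta> < \<alpha> \<Longrightarrow> x \<in> C \<beta> \<Longrightarrow> bond \<gamma> x \<in> C \<gamma>"
  shows "compact {x. bond \<alpha> x = x \<and> (\<forall>\<beta><\<alpha>. bond \<beta> x \<in> C \<beta>)}"
    and "connected {x. bond \<alpha> x = x \<and> (\<forall>\<beta><\<alpha>. bond \<beta> x \<in> C \<beta>)}"
proof -
  let ?L = "{x. bond \<alpha> x = x \<and> (\<forall>\<beta><\<alpha>. bond \<beta> x \<in> C \<beta>)}"
  let ?F = "(\<lambda>\<beta>. cylinder \<alpha> \<beta> (C \<beta>)) ` {..<\<alpha>}"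
  have cyl: "compact S \<and> connected S" if "S \<in> ?F" for S
    using that compact_connected_cylinder[of _ \<alpha>] C fixed unit by (auto simp: less_imp_le)
  have ne: "?F \<noteq> {}" using olimit_pos[OF \<alpha>] by auto
  have mono: "cylinder \<alpha> \<beta> (C \<beta>) \<subseteq> cylinder \<alpha> \<gamma> (C \<gamma>)" if "\<gamma> \<le> \<beta>" "\<beta> < \<alpha>" for \<beta> \<gamma>
  proof
    fix x assume x: "x \<in> cylinder \<alpha> \<beta> (C \<beta>)"
    then have "bond \<gamma> (bond \<beta> x) \<in> C \<gamma>"
      using bonds[OF that] by (simp add: cylinder_def del: bond_bond)
    then show "x \<in> cylinder \<alpha> \<gamma> (C \<gamma>)" using x that by (simp add: cylinder_def min_absorb1)
  qed
  have L: "?L = \<Inter>?F"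
  proof (intro equalityI subsetI)
    fix x assume x: "x \<in> ?L"
    have "snd x \<gamma> \<in> {0..1}" for \<gamma>
    proof (cases "\<gamma> < \<alpha>")
      case True
      then have "snd (bond (osucc \<gamma>) x) \<gamma> \<in> {0..1}"
        using x olimit_osucc[OF \<alpha> True] unit by blast
      then show ?thesis by (simp add: bond_def)
    next
      case False
      then show ?thesis using x by (auto simp: bond_eq_iff)
    qed
    then show "x \<in> \<Inter>?F" using x by (auto simp: cylinder_def)
  next
    fix x assume "x \<in> \<Inter>?F"
    then show "x \<in> ?L" using olimit_pos[OF \<alpha>] by (auto simp: cylinder_def)
  qed
  show "connected ?L"
    unfolding L
  proof (rule connected_compact_chain[OF ne cyl])
    show "S \<subseteq> T \<or> T \<subseteq> S" if ST: "S \<in> ?F" "T \<in> ?F" for S T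
    proof -
      obtain \<beta> \<gamma> where "\<beta> < \<alpha>" "\<gamma> < \<alpha>" "S = cylinder \<alpha> \<beta> (C \<beta>)" "T = cylinder \<alpha> \<gamma> (C \<gamma>)"
        using ST by blast
      then show ?thesis using mono[of \<beta> \<gamma>] mono[of \<gamma> \<beta>] by (cases "\<beta> \<le> \<gamma>") auto
    qed
  qed
  obtain S where S: "S \<in> ?F" using ne by blast
  have "closed (\<Inter>?F)" using cyl by (intro closed_Inter) (auto simp: compact_imp_closed)
  then have "compact (S \<inter> \<Inter>?F)" using cyl[OF S] by (intro compact_Int_closed) auto
  moreover have "S \<inter> \<Inter>?F = \<Inter>?F" using S by blast
  ultimately show "compact ?L" unfolding L by simp
qed

lemma bond_determined:
  assumes "olimit \<alpha>" "\<And>\<beta>. \<beta> < \<alpha> \<Longrightarrow> bond \<beta> x = bond \<beta> y"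
  shows "bond \<alpha> x = bond \<alpha> y"
  using glue_bond[OF assms(1), of x] glue_bond[OF assms(1), of y] assms(2)
  by (metis (no_types, lifting) lessThan_iff restrict_ext)

text \<open>The points of \<open>K\<close> that agree with \<open>x\<close> below \<open>\<beta>\<close> form a decreasing family of nonempty compact
  sets; a point common to all of them agrees with \<open>x\<close> everywhere.\<close>

lemma mem_compact_if_bonds:
  assumes \<alpha>: "olimit \<alpha>" and K: "compact K" "\<And>y. y \<in> K \<Longrightarrow> bond \<alpha> y = y" and x: "bond \<alpha> x = x"
    and approx: "\<And>\<beta>. \<beta> < \<alpha> \<Longrightarrow> bond \<beta> x \<in> bond \<beta> ` K"
  shows "x \<in> K"
proof (rule ccontr)
  assume "x \<notin> K"
  let ?A = "\<lambda>\<beta>. {y \<in> K. bond \<beta> y = bond \<beta> x}"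
  have mono: "?A \<beta> \<subseteq> ?A \<gamma>" if "\<gamma> \<le> \<beta>" for \<beta> \<gamma>
  proof -
    have *: "bond \<gamma> z = bond \<gamma> (bond \<beta> z)" for z using that by (simp add: min_absorb1)
    show ?thesis
    proof
      fix y assume y: "y \<in> ?A \<beta>"
      then have "bond \<beta> y = bond \<beta> x" by simp
      then have "bond \<gamma> y = bond \<gamma> x" using *[of y] *[of x] by metis
      then show "y \<in> ?A \<gamma>" using y by simp
    qed
  qed
  have "\<exists>S \<in> ?A ` {..<\<alpha>}. S \<subseteq> {}"
  proof (rule compact_chain_subset_open)
    show "?A ` {..<\<alpha>} \<noteq> {}" using olimit_pos[OF \<alpha>] by auto
    show "compact S" if S': "S \<in> ?A ` {..<\<alpha>}" for S
    proof -
      obtain \<beta> where S: "S = ?A \<beta>" using S' by (rule imageE)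
      have "closed (bond \<beta> -` {bond \<beta> x})"
        using continuous_on_bond[of UNIV \<beta>] by (intro closed_vimage) (auto simp: continuous_on_eq_continuous_at)
      then have "compact (K \<inter> bond \<beta> -` {bond \<beta> x})" using K(1) by blast
      moreover have "S = K \<inter> bond \<beta> -` {bond \<beta> x}" unfolding S by auto
      ultimately show ?thesis by simp
    qed
    show "S \<subseteq> T \<or> T \<subseteq> S" if ST: "S \<in> ?A ` {..<\<alpha>}" "T \<in> ?A ` {..<\<alpha>}" for S T
    proof -
      obtain \<beta> \<gamma> where "S = ?A \<beta>" "T = ?A \<gamma>" using ST by (elim imageE)
      then show ?thesis using mono[of \<beta> \<gamma>] mono[of \<gamma> \<beta>] by (cases "\<beta> \<le> \<gamma>") auto
    qed
    show "\<Inter> (?A ` {..<\<alpha>}) \<subseteq> {}"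
    proof
      fix y assume y: "y \<in> \<Inter> (?A ` {..<\<alpha>})"
      then have "y \<in> K" using olimit_pos[OF \<alpha>] by auto
      moreover have "bond \<alpha> y = bond \<alpha> x" using y by (intro bond_determined[OF \<alpha>]) auto
      ultimately show "y \<in> {}" using K(2) x \<open>x \<notin> K\<close> by auto
    qed
  qed simp
  then obtain \<beta> where \<beta>: "\<beta> < \<alpha>" "?A \<beta> = {}" by auto
  obtain y where "y \<in> K" "bond \<beta> y = bond \<beta> x" using approx[OF \<beta>(1)] by (metis imageE)
  then show False using \<beta>(2) by blast
qed

section \<open>The stages are continua\<close>

text \<open>The sequence \<open>a, q\<^sup>1, a, q\<^sup>2, a, \<dots>\<close> of corners of the spiral.  Consecutive corners number
  \<open>2k\<close>, \<open>2k + 1\<close> and \<open>2k + 2\<close> are \<open>a\<close>, \<open>q (k + 1)\<close> and \<open>a\<close>, so the rungs \<open>2k\<close> and \<open>2k + 1\<close>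
  are both copies of the interval from \<open>a\<close> to \<open>q (k + 1)\<close>.\<close>

definition corner :: "'a \<Rightarrow> (nat \<Rightarrow> 'a) \<Rightarrow> nat \<Rightarrow> 'a" where
  "corner a q m = (if even m then a else q (Suc (m div 2)))"

lemma interval_corners:
  "interval T (corner a q m) (corner a q (Suc m)) = interval T a (q (Suc (m div 2)))"
proof (cases "even m")
  case False
  then show ?thesis
    using interval_commute[of T a "q (Suc (m div 2))"] by (simp add: corner_def)
qed (simp add: corner_def)

lemma succ_space_eq_total:
  assumes "spiral X (corner a q)"
  shows "succ_space (top_of_set X) a q = spiral.total X (corner a q)"
proof -
  interpret spiral X "corner a q" by fact
  let ?I = "\<lambda>k. interval (top_of_set X) a (q (Suc k))"
  have UN_Suc: "(\<Union>n\<in>{1..}. F n) = (\<Union>k. F (Suc k))" for F :: "nat \<Rightarrow> ('a \<times> real) set"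
  proof -
    have "{1..} = range Suc" by (auto simp: Suc_le_eq gr0_conv_Suc)
    then show ?thesis by simp
  qed
  have h: "1 / (2 * real (Suc k) - 1) = height (2 * k)" "1 / (2 * real (Suc k)) = height (2 * k + 1)"
    "1 / (2 * real (Suc k) + 1) = height (2 * k + 2)" for k
    by (simp_all add: height_def algebra_simps)
  have UN_even_odd: "(\<Union>m. turn m) = (\<Union>k. turn (2 * k) \<union> turn (2 * k + 1))"
  proof (intro equalityI subsetI)
    fix z assume "z \<in> (\<Union>m. turn m)"
    then obtain m where "z \<in> turn m" by blast
    then show "z \<in> (\<Union>k. turn (2 * k) \<union> turn (2 * k + 1))"
      by (cases "even m") (auto elim!: evenE oddE)
  qed blast
  have t: "turn (2 * k) = ?I k \<times> {height (2 * k)} \<union> {q (Suc k)} \<times> {height (2 * k + 1)..height (2 * k)}"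
    "turn (2 * k + 1) = ?I k \<times> {height (2 * k + 1)} \<union> {a} \<times> {height (2 * k + 2)..height (2 * k + 1)}" for k
    unfolding turn_def rung_def interval_corners by (simp_all add: corner_def)
  have "succ_space (top_of_set X) a q =
    X \<times> {0} \<union> (\<Union>k. (?I k \<times> {height (2 * k), height (2 * k + 1)} \<union>
      {q (Suc k)} \<times> {height (2 * k + 1)..height (2 * k)}) \<union>
      {a} \<times> {height (2 * k + 2)..height (2 * k + 1)})"
    unfolding succ_space_def UN_Suc h UN_Un_distrib by auto
  also have "\<dots> = X \<times> {0} \<union> (\<Union>k. turn (2 * k) \<union> turn (2 * k + 1))"
  proof -
    have "?I k \<times> {height (2 * k), height (2 * k + 1)} \<union>
        {q (Suc k)} \<times> {height (2 * k + 1)..height (2 * k)} \<union>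
        {a} \<times> {height (2 * k + 2)..height (2 * k + 1)} = turn (2 * k) \<union> turn (2 * k + 1)" for k
      unfolding t by blast
    then show ?thesis by simp
  qed
  also have "\<dots> = total" unfolding total_def UN_even_odd ..
  finally show ?thesis .
qed

lemma coordinate_unit:
  assumes p: "chosen_sequence p" and x: "x \<in> Xs p \<alpha>"
  shows "snd x \<gamma> \<in> {0..1}"
proof (cases "\<gamma> < \<alpha>")
  case True
  then have "osucc \<gamma> \<le> \<alpha>" using less_osucc_iff not_le by blast
  then have "bond (osucc \<gamma>) x \<in> Xs p (osucc \<gamma>)" using bond_in[OF p x] by blast
  then obtain y t where "bond (osucc \<gamma>) x = adjoin \<gamma> y t" "t \<in> {0..1}"
    using well_coded_succ_space[OF well_coded[OF p]] unfolding X_succ by fast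
  then have "snd (bond (osucc \<gamma>) x) \<gamma> \<in> {0..1}" by (simp add: adjoin_def)
  then show ?thesis by (simp add: bond_def)
next
  case False
  then show ?thesis using bond_fixed[OF p x] by (simp add: bond_eq_iff)
qed

lemma a_neq_q:
  assumes p: "chosen_sequence p" and n: "1 \<le> n"
  shows "pt_a p \<alpha> \<noteq> pt_q p n \<alpha>"
proof
  assume "pt_a p \<alpha> = pt_q p n \<alpha>"
  then have "pt_a p 0 = pt_q p n 0" using bond_a[OF p, of 0 \<alpha>] bond_q[OF p n, of 0 \<alpha>] by simp
  moreover have "- 2 / pi < fst (p n)" using p n by (auto simp: chosen_sequence_def)
  ultimately show False by (metis a_zero q_zero fst_conv less_irrefl)
qed

lemma Xs_limit:
  assumes p: "chosen_sequence p" and \<alpha>: "olimit \<alpha>"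
  shows "Xs p \<alpha> = {x. bond \<alpha> x = x \<and> (\<forall>\<beta><\<alpha>. bond \<beta> x \<in> Xs p \<beta>)}"
proof (intro equalityI subsetI)
  fix x assume "x \<in> Xs p \<alpha>"
  then show "x \<in> {x. bond \<alpha> x = x \<and> (\<forall>\<beta><\<alpha>. bond \<beta> x \<in> Xs p \<beta>)}"
    using bond_fixed[OF p] bond_in[OF p] by (auto simp: less_imp_le)
next
  fix x assume x: "x \<in> {x. bond \<alpha> x = x \<and> (\<forall>\<beta><\<alpha>. bond \<beta> x \<in> Xs p \<beta>)}"
  then have "(\<lambda>\<beta>\<in>{..<\<alpha>}. bond \<beta> x) \<in> threads \<alpha> (Xs p)"
    by (auto simp: threads_def min_absorb1)
  moreover have "glue \<alpha> (\<lambda>\<beta>\<in>{..<\<alpha>}. bond \<beta> x) = x" using glue_bond[OF \<alpha>] x by simp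
  ultimately show "x \<in> Xs p \<alpha>" unfolding X_limit[OF \<alpha>] by (metis imageI)
qed

definition reach :: "(nat \<Rightarrow> real \<times> real) \<Rightarrow> nat \<Rightarrow> ordinal \<Rightarrow> point set" where
  "reach p n \<alpha> = interval (X_space p \<alpha>) (pt_a p \<alpha>) (pt_q p n \<alpha>)"

text \<open>The induction hypothesis of the transfinite recursion.  Connectedness of the intervals
  \<open>[a, q\<^sup>n]\<close> makes the next stage connected.  Their monotonicity in \<open>n\<close> is what makes the bonding
  maps respect them at a successor step, since the spiral from the top to \<open>q\<^sup>n\<close> projects onto the
  union of the intervals \<open>[a, q\<^sup>k]\<close> with \<open>k \<le> n\<close>; and that they are respected makes them an inverse system at a
  limit step.\<close>

definition tame :: "(nat \<Rightarrow> real \<times> real) \<Rightarrow> ordinal \<Rightarrow> bool" where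
  "tame p \<alpha> \<longleftrightarrow> compact (Xs p \<alpha>) \<and> connected (Xs p \<alpha>) \<and>
     (\<forall>n\<ge>1. connected (reach p n \<alpha>) \<and> reach p n \<alpha> \<subseteq> reach p (Suc n) \<alpha> \<and>
       (\<forall>\<beta><\<alpha>. bond \<beta> ` reach p n \<alpha> \<subseteq> reach p n \<beta>))"

lemma tame_reach_mono:
  assumes "tame p \<alpha>" "1 \<le> m" "m \<le> n"
  shows "reach p m \<alpha> \<subseteq> reach p n \<alpha>"
  using assms(3)
proof (induction n rule: dec_induct)
  case (step n)
  then show ?case using assms by (meson le_trans order_trans tame_def)
qed simp

lemma tame_zero:
  assumes p: "chosen_sequence p"
  shows "tame p 0"
proof -
  let ?f = "\<lambda>z :: real \<times> real. (z, \<lambda>_ :: ordinal. 0 :: real)"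
  have f: "continuous_on S ?f" for S by (intro continuous_intros)
  have u: "- 2 / pi < fst (p n)" "fst (p n) < 0" "p n = (fst (p n), sin (1 / fst (p n)))" if "1 \<le> n" for n
    using p that by (auto simp: chosen_sequence_def)
  have r: "reach p n 0 = ?f ` sine_arc (fst (p n))" if n: "1 \<le> n" for n
  proof -
    have "reach p n 0 = ?f ` interval (top_of_set sin_curve) (- 2 / pi, -1) (p n)"
      unfolding reach_def X_zero a_zero q_zero
      by (rule interval_homeomorphic_image[where g = fst])
        (use a_zero_in q_zero_in[OF p n] in \<open>auto intro!: f continuous_intros\<close>)
    then show ?thesis using interval_sin_curve[OF u(1,2)[OF n]] u(3)[OF n] by simp
  qed
  have "compact (Xs p 0)" "connected (Xs p 0)"
    unfolding X_zero
    using compact_continuous_image[OF f compact_sin_curve] connected_continuous_image[OF f connected_sin_curve] by auto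
  moreover have "connected (reach p n 0)" if n: "1 \<le> n" for n
    unfolding r[OF n] using connected_continuous_image[OF f compact_connected_sine_arc(2)[OF u(2)[OF n]]] .
  moreover have "reach p n 0 \<subseteq> reach p (Suc n) 0" if n: "1 \<le> n" for n
  proof -
    have "fst (p n) < fst (p (Suc n))"
      using p n by (auto simp: chosen_sequence_def strict_mono_on_def)
    then have "sine_arc (fst (p n)) \<subseteq> sine_arc (fst (p (Suc n)))" by (auto simp: sine_arc_def)
    then show ?thesis using r[OF n] r[of "Suc n"] by auto
  qed
  moreover have "\<not> \<beta> < 0" for \<beta> :: ordinal by (simp add: not_less)
  ultimately show ?thesis unfolding tame_def by blast
qed

lemma spiral_stage:
  assumes p: "chosen_sequence p" and t: "tame p \<beta>"
  shows "spiral (Xs p \<beta>) (corner (pt_a p \<beta>) (\<lambda>n. pt_q p n \<beta>))"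
proof
  show "compact (Xs p \<beta>)" using t by (simp add: tame_def)
  fix m
  show "corner (pt_a p \<beta>) (\<lambda>n. pt_q p n \<beta>) m \<in> Xs p \<beta>"
    using a_in[OF p] q_in[OF p] by (simp add: corner_def)
  show "corner (pt_a p \<beta>) (\<lambda>n. pt_q p n \<beta>) m \<noteq> corner (pt_a p \<beta>) (\<lambda>n. pt_q p n \<beta>) (Suc m)"
    using a_neq_q[OF p, of "Suc (m div 2)" \<beta>] by (auto simp: corner_def)
  show "connected (interval (X_space p \<beta>) (corner (pt_a p \<beta>) (\<lambda>n. pt_q p n \<beta>) m)
      (corner (pt_a p \<beta>) (\<lambda>n. pt_q p n \<beta>) (Suc m)))"
    unfolding interval_corners using t by (simp add: tame_def reach_def)
qed

text \<open>In the spiral, the interval from \<open>a\<close> to \<open>q (k + 1)\<close> is the part at height at least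
  \<open>height (2 * k)\<close>, so it is connected and evidently increases with \<open>k\<close>.\<close>

lemma tame_succ:
  assumes p: "chosen_sequence p" and t: "tame p \<beta>"
  shows "tame p (osucc \<beta>)"
proof -
  let ?c = "corner (pt_a p \<beta>) (\<lambda>n. pt_q p n \<beta>)"
  interpret spiral "Xs p \<beta>" ?c by (rule spiral_stage[OF p t])
  let ?f = "\<lambda>z. adjoin \<beta> (fst z) (snd z)" and ?g = "\<lambda>x. (bond \<beta> x, snd x \<beta>)"
  have X: "Xs p (osucc \<beta>) = ?f ` total"
    unfolding X_succ succ_space_eq_total[OF spiral_axioms] by (simp add: case_prod_unfold)
  have f: "continuous_on S ?f" for S
  proof (rule continuous_on_point)
    show "continuous_on S (\<lambda>z. snd (adjoin \<beta> (fst z) (snd z)) \<gamma>)" for \<gamma>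
      by (cases "\<gamma> = \<beta>") (auto simp: adjoin_def intro!: continuous_on_coord continuous_intros)
  qed (auto simp: adjoin_def intro!: continuous_intros)
  have g: "continuous_on S ?g" for S
    by (intro continuous_on_Pair continuous_on_bond continuous_on_coord continuous_on_id)
  have bond_f: "bond \<beta> (?f z) = fst z" if "z \<in> total" for z
    using that total_subset bond_fixed[OF p, of "fst z" \<beta>] by (auto simp: bond_adjoin)
  have gf: "?g (?f z) = z" if "z \<in> total" for z
    using bond_f[OF that] by (simp add: adjoin_def)
  have r: "reach p (Suc k) (osucc \<beta>) = ?f ` tail (2 * k)" for k
  proof -
    have a: "pt_a p (osucc \<beta>) = ?f (?c 0, height 0)" by (simp add: a_succ corner_def)
    have "1 / (2 * real (Suc k) - 1) = height (2 * k)" by (simp add: height_def)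
    then have q: "pt_q p (Suc k) (osucc \<beta>) = ?f (?c (Suc (2 * k)), height (2 * k))"
      by (simp add: q_succ corner_def)
    have "reach p (Suc k) (osucc \<beta>) = ?f ` interval (top_of_set total) (?c 0, height 0) (?c (Suc (2 * k)), height (2 * k))"
      unfolding reach_def X a q
    proof (rule interval_homeomorphic_image[where g = ?g])
      show "(?c 0, height 0) \<in> total" "(?c (Suc (2 * k)), height (2 * k)) \<in> total"
        using corner_in_turn(1)[of 0] corner_in_turn(3)[of "2 * k"] unfolding total_def by blast+
    qed (use f g gf in auto)
    then show ?thesis unfolding interval_total .
  qed
  have "compact (Xs p (osucc \<beta>))"
    unfolding X by (rule compact_continuous_image[OF f compact_total])
  moreover have "connected (Xs p (osucc \<beta>))"
    unfolding X
    by (rule connected_continuous_image[OF f connected_total])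
      (use t in \<open>simp_all add: tame_def corner_def\<close>)
  moreover have "connected (reach p n (osucc \<beta>))" if n: "1 \<le> n" for n
  proof -
    obtain k where "n = Suc k" using n by (cases n) auto
    then show ?thesis
      using connected_continuous_image[OF f connected_tail[of "2 * k"]] by (simp only: r)
  qed
  moreover have "reach p n (osucc \<beta>) \<subseteq> reach p (Suc n) (osucc \<beta>)" if n: "1 \<le> n" for n
  proof -
    obtain k where k: "n = Suc k" using n by (cases n) auto
    have "height (2 * Suc k) \<le> height (2 * k)" by simp
    then have "tail (2 * k) \<subseteq> tail (2 * Suc k)" unfolding tail_def by (auto simp del: height_le_iff)
    then show ?thesis unfolding k r by blast
  qed
  moreover have "bond \<gamma> ` reach p n (osucc \<beta>) \<subseteq> reach p n \<gamma>" if n: "1 \<le> n" and \<gamma>: "\<gamma> < osucc \<beta>" for n \<gamma>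
  proof
    fix y assume "y \<in> bond \<gamma> ` reach p n (osucc \<beta>)"
    moreover obtain k where k: "n = Suc k" using n by (cases n) auto
    ultimately obtain z where z: "z \<in> tail (2 * k)" "y = bond \<gamma> (?f z)" by (auto simp: r)
    have "\<gamma> \<le> \<beta>" using \<gamma> by (simp add: less_osucc_iff)
    then have y: "y = bond \<gamma> (fst z)" using z(2) by (simp add: bond_adjoin)
    obtain m where m: "m \<le> 2 * k" "fst z \<in> rung m"
      using z(1) by (rule tail_over_rung)
    have "fst z \<in> reach p (Suc (m div 2)) \<beta>"
      using m(2) unfolding rung_def interval_corners reach_def .
    moreover have "m div 2 \<le> k" using m(1) by simp
    ultimately have "fst z \<in> reach p n \<beta>" using tame_reach_mono[OF t, of "Suc (m div 2)" n] k by auto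
    then show "y \<in> reach p n \<gamma>"
    proof (cases "\<gamma> = \<beta>")
      case True
      have "fst z \<in> Xs p \<beta>" using m(2) rung_subset by auto
      then show ?thesis using True y bond_fixed[OF p] \<open>fst z \<in> reach p n \<beta>\<close> by simp
    next
      case False
      then have "\<gamma> < \<beta>" using \<open>\<gamma> \<le> \<beta>\<close> by simp
      then have "bond \<gamma> ` reach p n \<beta> \<subseteq> reach p n \<gamma>" using t n unfolding tame_def by blast
      then show ?thesis using y \<open>fst z \<in> reach p n \<beta>\<close> by blast
    qed
  qed
  ultimately show ?thesis unfolding tame_def by blast
qed

lemma reach_subset: "reach p n \<alpha> \<subseteq> Xs p \<alpha>"
  using interval_subset[of "X_space p \<alpha>"] by (simp add: reach_def)

lemma ends_in_reach:
  assumes "chosen_sequence p" "1 \<le> n"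
  shows "pt_a p \<alpha> \<in> reach p n \<alpha>" "pt_q p n \<alpha> \<in> reach p n \<alpha>"
  unfolding reach_def
  by (rule endpoints_in_interval; simp add: a_in[OF assms(1)] q_in[OF assms])+

text \<open>The inverse limit of the intervals is a subcontinuum containing both ends.  Conversely, the
  image in \<open>X(\<beta>)\<close> of a subcontinuum containing both ends contains the interval there, so every
  thread through the intervals is approximated by points of the subcontinuum in all coordinates.\<close>

lemma reach_limit:
  assumes p: "chosen_sequence p" and \<alpha>: "olimit \<alpha>" and t: "\<And>\<beta>. \<beta> < \<alpha> \<Longrightarrow> tame p \<beta>"
    and n: "1 \<le> n"
  shows "reach p n \<alpha> = {x. bond \<alpha> x = x \<and> (\<forall>\<beta><\<alpha>. bond \<beta> x \<in> reach p n \<beta>)}"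
    and "connected (reach p n \<alpha>)"
proof -
  let ?L = "{x. bond \<alpha> x = x \<and> (\<forall>\<beta><\<alpha>. bond \<beta> x \<in> reach p n \<beta>)}"
  have sub: "x \<in> Xs p \<beta>" if "x \<in> reach p n \<beta>" for x \<beta> using that reach_subset by blast
  have bonds: "bond \<gamma> x \<in> reach p n \<gamma>" if "\<gamma> \<le> \<beta>" "\<beta> < \<alpha>" "x \<in> reach p n \<beta>" for \<beta> \<gamma> x
  proof (cases "\<gamma> = \<beta>")
    case True
    then show ?thesis using that(3) bond_fixed[OF p sub[OF that(3)]] by simp
  next
    case False
    then have "\<gamma> < \<beta>" using that(1) by simp
    then show ?thesis using t[OF that(2)] that(3) n unfolding tame_def by blast
  qed
  have comp: "compact (reach p n \<beta>)" "connected (reach p n \<beta>)" if "\<beta> < \<alpha>" for \<beta>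
    using t[OF that] n compact_interval by (auto simp: tame_def reach_def)
  note L = compact_connected_inverse_limit[of \<alpha> "reach p n", OF \<alpha> comp bond_fixed[OF p sub]
      coordinate_unit[OF p sub] bonds]
  show eq: "reach p n \<alpha> = ?L"
    unfolding reach_def[of p n \<alpha>]
  proof (rule interval_eqI)
    show "?L \<subseteq> Xs p \<alpha>" unfolding Xs_limit[OF p \<alpha>] using sub by blast
    show "pt_a p \<alpha> \<in> ?L" "pt_q p n \<alpha> \<in> ?L"
      using bond_a[OF p] bond_q[OF p n] ends_in_reach[OF p n] by (auto simp: less_imp_le)
    show "pt_a p \<alpha> \<noteq> pt_q p n \<alpha>" by (rule a_neq_q[OF p n])
    fix K assume K: "K \<subseteq> Xs p \<alpha>" "compact K" "connected K" "pt_a p \<alpha> \<in> K" "pt_q p n \<alpha> \<in> K"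
    show "?L \<subseteq> K"
    proof
      fix x assume x: "x \<in> ?L"
      show "x \<in> K"
      proof (rule mem_compact_if_bonds[OF \<alpha> K(2)])
        show "bond \<alpha> x = x" using x by blast
        show "bond \<alpha> y = y" if "y \<in> K" for y using that K(1) bond_fixed[OF p] by blast
        show "bond \<beta> x \<in> bond \<beta> ` K" if \<beta>: "\<beta> < \<alpha>" for \<beta>
        proof -
          have "reach p n \<beta> \<subseteq> bond \<beta> ` K"
            unfolding reach_def
          proof (rule interval_least)
            show "bond \<beta> ` K \<subseteq> Xs p \<beta>" using K(1) bond_in[OF p] \<beta> by (auto simp: less_imp_le)
            show "pt_a p \<beta> \<in> bond \<beta> ` K" using K(4) bond_a[OF p less_imp_le[OF \<beta>]] by (metis imageI)
            show "pt_q p n \<beta> \<in> bond \<beta> ` K" using K(5) bond_q[OF p n less_imp_le[OF \<beta>]] by (metis imageI)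
          qed (use a_neq_q[OF p n] K(2,3) in
              \<open>auto intro: compact_continuous_image connected_continuous_image continuous_on_bond\<close>)
          then show ?thesis using x \<beta> by blast
        qed
      qed
    qed
  qed (use L in auto)
  show "connected (reach p n \<alpha>)" unfolding eq by (rule L(2))
qed

lemma tame_limit:
  assumes p: "chosen_sequence p" and \<alpha>: "olimit \<alpha>" and t: "\<And>\<beta>. \<beta> < \<alpha> \<Longrightarrow> tame p \<beta>"
  shows "tame p \<alpha>"
proof -
  have comp: "compact (Xs p \<beta>)" "connected (Xs p \<beta>)" if "\<beta> < \<alpha>" for \<beta>
    using t[OF that] by (simp_all add: tame_def)
  have bonds: "bond \<gamma> x \<in> Xs p \<gamma>" if "\<gamma> \<le> \<beta>" "\<beta> < \<alpha>" "x \<in> Xs p \<beta>" for \<beta> \<gamma> x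
    using bond_in[OF p that(3,1)] .
  note L = compact_connected_inverse_limit[of \<alpha> "Xs p", OF \<alpha> comp bond_fixed[OF p]
      coordinate_unit[OF p] bonds]
  have "compact (Xs p \<alpha>)" "connected (Xs p \<alpha>)"
    unfolding Xs_limit[OF p \<alpha>] using L by auto
  moreover have "reach p n \<alpha> \<subseteq> reach p (Suc n) \<alpha>" if n: "1 \<le> n" for n
  proof -
    have "reach p n \<beta> \<subseteq> reach p (Suc n) \<beta>" if "\<beta> < \<alpha>" for \<beta>
      using t[OF that] n unfolding tame_def by blast
    then show ?thesis
      using reach_limit(1)[OF p \<alpha> t n] reach_limit(1)[OF p \<alpha> t, of "Suc n"] by auto
  qed
  moreover have "bond \<beta> ` reach p n \<alpha> \<subseteq> reach p n \<beta>" if n: "1 \<le> n" and "\<beta> < \<alpha>" for n \<beta>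
    using reach_limit(1)[OF p \<alpha> t n] that by auto
  ultimately show ?thesis unfolding tame_def using reach_limit(2)[OF p \<alpha> t] by blast
qed

lemma tame:
  assumes p: "chosen_sequence p"
  shows "tame p \<alpha>"
proof (induction \<alpha> rule: less_induct)
  case (less \<alpha>)
  show ?case
  proof (cases \<alpha> rule: ordinal_cases)
    case 1
    then show ?thesis using tame_zero[OF p] by simp
  next
    case (2 \<beta>)
    then show ?thesis using tame_succ[OF p less, of \<beta>] by simp
  next
    case 3
    then show ?thesis using tame_limit[OF p _ less] by simp
  qed
qed

lemma continuum_stage:
  assumes p: "chosen_sequence p"
  shows "continuum (X_space p \<alpha>)"
  unfolding continuum_top_of_set
proof (intro conjI)
  show "compact (Xs p \<alpha>)" "connected (Xs p \<alpha>)" using tame[OF p, of \<alpha>] by (simp_all add: tame_def)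
  have "pt_a p \<alpha> \<noteq> pt_q p 1 \<alpha>" by (rule a_neq_q[OF p]) simp
  then show "\<exists>x\<in>Xs p \<alpha>. \<exists>y\<in>Xs p \<alpha>. x \<noteq> y"
    using a_in[OF p, of \<alpha>] q_in[OF p, of 1 \<alpha>] by blast
qed

section \<open>Cellularity\<close>

lemma separable_imp_countable_disjoint_open:
  assumes "separable_space T" and "\<And>U. U \<in> \<U> \<Longrightarrow> openin T U" "\<And>U. U \<in> \<U> \<Longrightarrow> U \<noteq> {}"
    and "disjoint \<U>"
  shows "countable \<U>"
proof -
  obtain D where D: "countable D" "T closure_of D = topspace T"
    using assms(1) by (auto simp: separable_space_def)
  have "\<exists>d\<in>D. d \<in> U" if U: "U \<in> \<U>" for U
  proof -
    have "openin T U" "U \<noteq> {}" "U \<subseteq> topspace T" using assms(2,3) U openin_subset by blast+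
    then show ?thesis using D(2) unfolding closure_of_def by blast
  qed
  then obtain d where d: "\<And>U. U \<in> \<U> \<Longrightarrow> d U \<in> D \<inter> U" by (metis IntI)
  have "inj_on d \<U>"
  proof (rule inj_onI)
    fix U V assume "U \<in> \<U>" "V \<in> \<U>" "d U = d V"
    then have "d U \<in> U \<inter> V" using d[of U] d[of V] by auto
    then show "U = V" using assms(4) \<open>U \<in> \<U>\<close> \<open>V \<in> \<U>\<close> unfolding disjoint_def by blast
  qed
  moreover have "countable (d ` \<U>)" 
  proof (rule countable_subset[OF _ D(1)])
    show "d ` \<U> \<subseteq> D" using d by blast
  qed
  ultimately show ?thesis by (rule countable_image_inj_on[rotated])
qed

text \<open>The open first connecting arc created at step \<open>\<beta>\<close>, pulled back to \<open>X\<close>.  Its ends are at heights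
  \<open>1\<close> and \<open>1/2\<close>, and no other point of \<open>X(\<beta> + 1)\<close> lies strictly between these heights.\<close>

definition cell :: "(nat \<Rightarrow> real \<times> real) \<Rightarrow> ordinal \<Rightarrow> point set" where
  "cell p \<beta> = {x \<in> Xs p omega1. snd x \<beta> \<in> {1/2<..<1}}"

lemma openin_cell: "openin (X_space p omega1) (cell p \<beta>)"
proof -
  have "open ((\<lambda>x :: point. snd x \<beta>) -` {1/2<..<1})"
    by (intro open_vimage continuous_on_coord continuous_on_id) auto
  moreover have "cell p \<beta> = Xs p omega1 \<inter> (\<lambda>x. snd x \<beta>) -` {1/2<..<1}"
    by (auto simp: cell_def)
  ultimately show ?thesis by (metis openin_open_Int)
qed

lemma connecting_arc_in_stage:
  assumes p: "chosen_sequence p"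
  shows "adjoin \<beta> (pt_q p 1 \<beta>) (3/4) \<in> Xs p (osucc \<beta>)"
proof -
  have "(pt_q p 1 \<beta>, 3/4) \<in> succ_space (X_space p \<beta>) (pt_a p \<beta>) (\<lambda>n. pt_q p n \<beta>)"
    unfolding succ_space_def by (intro UnI1 UnI2 UN_I[of 1]) auto
  then show ?thesis unfolding X_succ by force
qed

lemma cell_nonempty:
  assumes p: "chosen_sequence p" and \<beta>: "\<beta> < omega1"
  shows "cell p \<beta> \<noteq> {}"
proof -
  have "adjoin \<beta> (pt_q p 1 \<beta>) (3/4) \<in> Xs p omega1"
    using connecting_arc_in_stage[OF p] X_mono[OF p less_imp_le[OF olimit_osucc[OF olimit_omega1 \<beta>]]]
    by blast
  then have "adjoin \<beta> (pt_q p 1 \<beta>) (3/4) \<in> cell p \<beta>" by (simp add: cell_def adjoin_def)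
  then show ?thesis by blast
qed

lemma bond_cell:
  assumes p: "chosen_sequence p" and \<beta>: "\<beta> < omega1" and x: "x \<in> cell p \<beta>"
  shows "bond \<beta> x = pt_q p 1 \<beta>"
proof -
  interpret spiral "Xs p \<beta>" "corner (pt_a p \<beta>) (\<lambda>n. pt_q p n \<beta>)"
    by (rule spiral_stage[OF p tame[OF p]])
  have xX: "x \<in> Xs p omega1" "1/2 < snd x \<beta>" "snd x \<beta> < 1" using x by (auto simp: cell_def)
  have "bond (osucc \<beta>) x \<in> Xs p (osucc \<beta>)"
    using bond_in[OF p xX(1)] olimit_osucc[OF olimit_omega1 \<beta>] by simp
  then obtain y t where yt: "(y, t) \<in> total" "bond (osucc \<beta>) x = adjoin \<beta> y t"
    unfolding X_succ succ_space_eq_total[OF spiral_axioms] by auto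
  have "snd (bond (osucc \<beta>) x) \<beta> = t" unfolding yt(2) by (simp add: adjoin_def)
  then have "t = snd x \<beta>" by (simp add: bond_def)
  then have "y = corner (pt_a p \<beta>) (\<lambda>n. pt_q p n \<beta>) (Suc 0)"
    using fiber_between[OF yt(1), of 0] xX(2,3) by (simp add: height_def)
  then have y: "y = pt_q p 1 \<beta>" by (simp add: corner_def)
  have "bond \<beta> x = bond \<beta> (bond (osucc \<beta>) x)" by (simp add: min_absorb1 less_imp_le)
  also have "\<dots> = bond \<beta> y" unfolding yt(2) by (simp add: bond_adjoin)
  also have "\<dots> = pt_q p 1 \<beta>" unfolding y by (rule bond_q[OF p]) auto
  finally show ?thesis .
qed

text \<open>A point of the later cell lies over \<open>q\<^sup>1\<close> in \<open>X(\<gamma>)\<close>, hence over \<open>q\<^sup>1\<close> in \<open>X(\<beta> + 1)\<close>, which is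
  the upper end of the earlier arc and not in its interior.\<close>

lemma cells_disjoint:
  assumes p: "chosen_sequence p" and "\<beta> < \<gamma>" "\<gamma> < omega1"
  shows "cell p \<beta> \<inter> cell p \<gamma> = {}"
proof -
  have "snd x \<beta> = 1" if "x \<in> cell p \<gamma>" for x
  proof -
    have "osucc \<beta> \<le> \<gamma>" using assms(2) less_osucc_iff not_le by blast
    then have "bond (osucc \<beta>) x = bond (osucc \<beta>) (bond \<gamma> x)" by (simp add: min_absorb1)
    also have "\<dots> = pt_q p 1 (osucc \<beta>)"
      unfolding bond_cell[OF p assms(3) that] using \<open>osucc \<beta> \<le> \<gamma>\<close> by (intro bond_q[OF p]) auto
    finally have "snd (bond (osucc \<beta>) x) \<beta> = snd (pt_q p 1 (osucc \<beta>)) \<beta>" by simp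
    then show ?thesis by (simp add: q_succ adjoin_def bond_def)
  qed
  then have "x \<notin> cell p \<beta>" if "x \<in> cell p \<gamma>" for x using that by (simp add: cell_def)
  then show ?thesis by blast
qed

theorem claim21:
  fixes p :: "nat \<Rightarrow> real \<times> real"
  assumes "chosen_sequence p"
  shows "aleph1_cellular (X_space p omega1) \<and> \<not> separable_space (X_space p omega1)"
proof -
  note p = assms
  let ?U = "cell p ` {..<omega1}"
  have disj: "cell p \<beta> \<inter> cell p \<gamma> = {}" if "\<beta> < omega1" "\<gamma> < omega1" "\<beta> \<noteq> \<gamma>" for \<beta> \<gamma>
    using cells_disjoint[OF p, of \<beta> \<gamma>] cells_disjoint[OF p, of \<gamma> \<beta>] that
    by (cases "\<beta> < \<gamma>") (auto simp: Int_commute)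
  have inj: "inj_on (cell p) {..<omega1}"
  proof (rule inj_onI)
    fix \<beta> \<gamma> assume "\<beta> \<in> {..<omega1}" "\<gamma> \<in> {..<omega1}" "cell p \<beta> = cell p \<gamma>"
    then show "\<beta> = \<gamma>" using disj[of \<beta> \<gamma>] cell_nonempty[OF p, of \<beta>] by auto
  qed
  have U: "\<forall>U\<in>?U. openin (X_space p omega1) U \<and> U \<noteq> {}"
    using openin_cell cell_nonempty[OF p] by auto
  have "disjoint ?U" using disj by (auto simp: disjoint_def)
  have "|{..<omega1}| =o |?U|"
    using inj by (intro card_of_ordIsoI[of "cell p"]) (simp add: inj_on_imp_bij_betw)
  then have "|?U| =o cardSuc natLeq"
    using card_of_omega1 ordIso_symmetric ordIso_transitive by blast
  then have "aleph1_cellular (X_space p omega1)"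
    unfolding aleph1_cellular_def using continuum_stage[OF p] U \<open>disjoint ?U\<close> by blast
  moreover have "\<not> separable_space (X_space p omega1)"
  proof
    assume "separable_space (X_space p omega1)"
    then have "countable ?U"
      using separable_imp_countable_disjoint_open U \<open>disjoint ?U\<close> by blast
    then show False using countable_image_inj_on[OF _ inj] uncountable_omega1 by blast
  qed
  ultimately show ?thesis by blast
qed

end
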